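(* Let $(U(t,s))_{t\ge s}$ be an evolution family of bounded linear operators on a real separable Hilbert space $\mathbb{H}$ and let $(\mu_{t,s})_{t\ge s}$ be Borel probability measures on $\mathbb{H}$ such that $\mu_{t,s}=\mu_{t,r}*(\mu_{r,s}\circ U(t,r)^{-1})$ for all $t\ge r\ge s$. Suppose that for every $s\in\mathbb{R}$, $\mu_{t,s}\Rightarrow\delta_0$ as $t\downarrow s$, and that for every $t\in\mathbb{R}$, $\mu_{t,s}\Rightarrow\delta_0$ as $s\uparrow t$. Then for all $t\ge s$ the measure $\mu_{t,s}$ is infinitely divisible.
   Context: An evolution family on $\mathbb{H}$ is a family $(U(t,s))_{t\ge s}$, $s,t\in\mathbb{R}$, of bounded linear operators with $U(s,s)=I$, $U(t,r)U(r,s)=U(t,s)$ for $t\ge r\ge s$, and $(t,s)\mapsto U(t,s)x$ continuous on $\{t\ge s\}$ for each $x\in\mathbb{H}$. $\Rightarrow$ denotes weak convergence of probability measures. A probability measure $\mu$ on $\mathbb{H}$ is infinitely divisible if for every $n\in\mathbb{N}$ there is a probability measure $\mu_n$ with $\mu=\mu_n^{*n}$ ($n$-fold convolution). *)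

theory Defs
  imports "HOL-Probability.Probability"
begin

text \<open>
  A real separable Hilbert space is a type of sort \<open>{real_inner, polish_space}\<close>: an inner product
  space that is complete and second countable. A Borel probability measure on it is a measure
  \<open>M\<close> with \<open>prob_space M\<close> and \<open>sets M = sets borel\<close>.
\<close>

text \<open>The values \<open>U t s\<close> for \<open>t < s\<close> are arbitrary and never used.\<close>

definition evolution_family ::
  "(real \<Rightarrow> real \<Rightarrow> ('a::real_normed_vector \<Rightarrow>\<^sub>L 'a)) \<Rightarrow> bool" where
  "evolution_family U \<longleftrightarrow>
     (\<forall>s. U s s = id_blinfun) \<and>
     (\<forall>t r s. s \<le> r \<longrightarrow> r \<le> t \<longrightarrow> U t r o\<^sub>L U r s = U t s) \<and>
     (\<forall>x. continuous_on {(t, s). s \<le> t} (\<lambda>(t, s). blinfun_apply (U t s) x))"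

text \<open>
  The library constant \<open>convolution\<close> is restricted to the (finite-dimensional) class
  \<open>ordered_euclidean_space\<close>; this is the same definition without that restriction.
\<close>

definition measure_conv ::
  "'a::real_normed_vector measure \<Rightarrow> 'a measure \<Rightarrow> 'a measure" where
  "measure_conv M N = distr (M \<Otimes>\<^sub>M N) borel (\<lambda>(x, y). x + y)"

lemma measure_conv_eq_convolution:
  fixes M N :: "'a::ordered_euclidean_space measure"
  shows "measure_conv M N = convolution M N"
  by (simp add: measure_conv_def convolution_def)

fun measure_conv_power :: "nat \<Rightarrow> 'a::real_normed_vector measure \<Rightarrow> 'a measure" where
  "measure_conv_power 0 M = return borel 0"
| "measure_conv_power (Suc n) M = measure_conv M (measure_conv_power n M)"

definition infinitely_divisible :: "'a::real_normed_vector measure \<Rightarrow> bool" where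
  "infinitely_divisible M \<longleftrightarrow>
     prob_space M \<and> sets M = sets borel \<and>
     (\<forall>n\<ge>1. \<exists>N. prob_space N \<and> sets N = sets borel \<and> M = measure_conv_power n N)"

text \<open>
  The library's \<open>weak_conv_m\<close> covers only sequences of measures on the reals (via distribution
  functions).
\<close>

definition weakly_converges ::
  "('i \<Rightarrow> 'a::topological_space measure) \<Rightarrow> 'a measure \<Rightarrow> 'i filter \<Rightarrow> bool" where
  "weakly_converges M N F \<longleftrightarrow>
     (\<forall>f :: 'a \<Rightarrow> real. continuous_on UNIV f \<longrightarrow> bounded (range f) \<longrightarrow>
        ((\<lambda>i. \<integral>x. f x \<partial>(M i)) \<longlongrightarrow> (\<integral>x. f x \<partial>N)) F)"

end

theory Submission
  imports Defs
begin

text \<open>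
  Fix \<open>s \<le> t\<close>. Transport by \<open>U t b\<close> turns the measures into a family \<open>\<rho> b a\<close> of laws of increments over the intervals
  \<open>[a, b]\<close>, with \<open>\<rho> c a\<close> the convolution of \<open>\<rho> c b\<close> and \<open>\<rho> b a\<close>. A compactness argument
  (\<open>evolution_null_array\<close>) writes \<open>\<mu> t s\<close> as a convolution of finitely many laws that are as close to the point mass at 0 as
  desired, on any finite set of frequencies. It remains to prove, in a separable Hilbert space, that a measure with such null
  arrays is infinitely divisible (\<open>infinitely_divisible_if_null_arrays\<close>). Two problems have to be solved.

  The first one is to find approximate \<open>n\<close>-th roots. A law near the point mass at 0 is replaced by a mixture: keep the
  vector with probability \<open>1 / n\<close>, and take 0 otherwise. The \<open>n\<close>-th power of the characteristic function of the mixture is that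
  of the law up to a quadratic error, but such errors add up to something small only if the deviations
  of the characteristic functions from 1 have bounded sum. For this the factors are centered first. The centering chosen
  here makes the characteristic function positive at finitely many orthogonal frequencies \<open>f\<close>. Then \<open>sin (x \<bullet> f)\<close> has mean zero,
  and the deviation at \<open>h\<close> is bounded by a multiple of the sum of \<open>1 - \<bar>\<phi> f\<bar>\<close>, for all \<open>h\<close> in the group generated by these
  frequencies (\<open>first_order\<close>, \<open>centered_hchar_bound\<close>). The sum of \<open>1 - \<bar>\<phi> f\<bar>\<close> over the factors is at most
  minus the logarithm of the modulus of the product (\<open>approximate_root\<close>).

  The second problem is to pass to the limit without a compactness theorem in the Hilbert space. A countable divisible group
  of frequencies embeds the Hilbert space into the compact group of its characters, \<open>x\<close> being sent to the family
  of the numbers \<open>cis (x \<bullet> h)\<close>. Laws on the compact group have convergent subsequences (\<open>character_laws_compact\<close>) and are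
  determined by their coefficients (\<open>character_law_unique\<close>). So the approximate roots have a limit \<open>Q\<close>, whose \<open>n\<close>-th
  convolution power is the image of \<open>\<mu> t s\<close>. As this image is carried by the Hilbert space, which is a subgroup, Fubini's theorem
  shows that \<open>Q\<close> is carried by a coset of it. The translation \<open>c\<close> has its \<open>n\<close>-th power in the Hilbert space, hence by
  divisibility lies in the Hilbert space itself, and so \<open>Q\<close> is the image of a convolution root of \<open>\<mu> t s\<close>
  (\<open>conv_root_of_hchar_limit\<close>).
\<close>

section \<open>Laws on the group of characters\<close>

text \<open>
  Polynomials in a member of \<open>\<A>\<close> belong to \<open>\<A>\<close>, by Weierstrass so do continuous functions of it, and
  bounded limits of these give the indicators of its superlevel sets. The sets with indicator in \<open>\<A>\<close>
  form a \<open>\<sigma>\<close>-algebra. Bounds and limits are only asked for on a set \<open>S\<close>: in the application,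
  coordinates of complex sequences are bounded on the characters but not everywhere.
\<close>
lemma indicator_in_bounded_algebra:
  fixes \<A> :: "('b \<Rightarrow> real) set" and S :: "'b set"
  assumes space: "space M = UNIV"
    and meas: "\<And>f. f \<in> \<A> \<Longrightarrow> f \<in> borel_measurable M"
    and bdd: "\<And>f. f \<in> \<A> \<Longrightarrow> \<exists>B. \<forall>x\<in>S. \<bar>f x\<bar> \<le> B"
    and const: "\<And>c. (\<lambda>_. c) \<in> \<A>"
    and add: "\<And>f g. f \<in> \<A> \<Longrightarrow> g \<in> \<A> \<Longrightarrow> (\<lambda>x. f x + g x) \<in> \<A>"
    and mult: "\<And>f g. f \<in> \<A> \<Longrightarrow> g \<in> \<A> \<Longrightarrow> (\<lambda>x. f x * g x) \<in> \<A>"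
    and lim: "\<And>F f B. \<lbrakk>\<And>n::nat. F n \<in> \<A>; \<And>n x. x \<in> S \<Longrightarrow> \<bar>F n x\<bar> \<le> B; f \<in> borel_measurable M;
               \<And>x. x \<in> S \<Longrightarrow> (\<lambda>n. F n x) \<longlonglongrightarrow> f x\<rbrakk> \<Longrightarrow> f \<in> \<A>"
    and A: "A \<in> sigma_sets UNIV {{x. c < f x} | f c. f \<in> \<A>}"
  shows "(indicator A :: 'b \<Rightarrow> real) \<in> \<A>"
proof -
  have poly: "(\<lambda>x. p (f x)) \<in> \<A>" if "real_polynomial_function p" "f \<in> \<A>" for p :: "real \<Rightarrow> real" and f
    using that(1)
  proof induction
    case (linear g)
    then obtain c where "g = (\<lambda>x. x * c)" using real_bounded_linear by blast
    then show ?case using mult[OF that(2) const] by simp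
  qed (use const add mult in auto)
  have cont: "(\<lambda>x. g (f x)) \<in> \<A>" if g: "continuous_on UNIV g" and f: "f \<in> \<A>" for g :: "real \<Rightarrow> real" and f
  proof -
    obtain B where B: "\<And>x. x \<in> S \<Longrightarrow> \<bar>f x\<bar> \<le> B" using bdd[OF f] by blast
    have "\<exists>p. real_polynomial_function p \<and> (\<forall>y\<in>{-B..B}. \<bar>g y - p y\<bar> < 1 / real (Suc n))" for n
      using Stone_Weierstrass_real_polynomial_function[of "{-B..B}" g "1 / real (Suc n)"] g
      by (metis compact_Icc continuous_on_subset of_nat_0_less_iff subset_UNIV zero_less_Suc zero_less_divide_1_iff)
    then obtain p where p: "\<And>n. real_polynomial_function (p n)"
       and pg: "\<And>n y. y \<in> {-B..B} \<Longrightarrow> \<bar>g y - p n y\<bar> < 1 / real (Suc n)" by metis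
    have "compact (g ` {-B..B})"
      by (rule compact_continuous_image) (use g continuous_on_subset in auto)
    then obtain C where C: "\<And>y. y \<in> {-B..B} \<Longrightarrow> \<bar>g y\<bar> \<le> C"
      by (metis bounded_iff compact_imp_bounded image_eqI real_norm_def)
    show ?thesis
    proof (rule lim[of "\<lambda>n x. p n (f x)" "C + 1"])
      show "(\<lambda>x. p n (f x)) \<in> \<A>" for n using poly[OF p f] .
      fix x assume x: "x \<in> S"
      have fx: "f x \<in> {-B..B}" using B[OF x] by auto
      show "\<bar>p n (f x)\<bar> \<le> C + 1" for n
      proof -
        have "1 / real (Suc n) \<le> 1" by simp
        then show ?thesis using pg[OF fx, of n] C[OF fx] by linarith
      qed
      show "(\<lambda>n. p n (f x)) \<longlonglongrightarrow> g (f x)"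
      proof (rule LIM_zero_cancel, rule Lim_null_comparison)
        show "\<forall>\<^sub>F n in sequentially. norm (p n (f x) - g (f x)) \<le> 1 / real (Suc n)"
          using pg[OF fx] by (intro always_eventually allI) (simp add: abs_minus_commute less_imp_le del: of_nat_Suc)
        show "(\<lambda>n. 1 / real (Suc n)) \<longlonglongrightarrow> 0"
          using LIMSEQ_Suc[OF lim_const_over_n[of "1::real"]] by simp
      qed
    next
      show "(\<lambda>x. g (f x)) \<in> borel_measurable M"
        using meas[OF f] borel_measurable_continuous_onI[OF g] by measurable
    qed
  qed
  have gen: "(indicator {x. c < f x} :: 'b \<Rightarrow> real) \<in> \<A>" if f: "f \<in> \<A>" for f c
  proof (rule lim[of "\<lambda>n x. min 1 (max 0 (real n * (f x - c)))" 1])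
    show "(\<lambda>x. min 1 (max 0 (real n * (f x - c)))) \<in> \<A>" for n
      by (rule cont[OF _ f, of "\<lambda>y. min 1 (max 0 (real n * (y - c)))"]) (intro continuous_intros)
    show "\<bar>min 1 (max 0 (real n * (f x - c)))\<bar> \<le> 1" for n x by auto
    show "(indicator {x. c < f x} :: 'b \<Rightarrow> real) \<in> borel_measurable M"
    proof (rule borel_measurable_indicator)
      show "{x. c < f x} \<in> sets M"
        using measurable_sets[OF meas[OF f], of "{c<..}"] space by (simp add: vimage_def)
    qed
    fix x
    show "(\<lambda>n. min 1 (max 0 (real n * (f x - c)))) \<longlonglongrightarrow> indicator {x. c < f x} x"
    proof (cases "c < f x")
      case True
      obtain N where N: "real N * (f x - c) > 1" using True reals_Archimedean3[of "f x - c"] by auto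
      have "\<forall>\<^sub>F n in sequentially. min 1 (max 0 (real n * (f x - c))) = 1"
      proof (rule eventually_sequentiallyI[of N])
        fix n assume "N \<le> n"
        then have "real N * (f x - c) \<le> real n * (f x - c)" using True by (intro mult_right_mono) auto
        then show "min 1 (max 0 (real n * (f x - c))) = 1" using N by auto
      qed
      then show ?thesis using True by (simp add: tendsto_eventually)
    next
      case False
      then have "min 1 (max 0 (real n * (f x - c))) = 0" for n
        by (simp add: mult_nonneg_nonpos)
      then show ?thesis using False by simp
    qed
  qed
  have compl: "(indicator (UNIV - X) :: 'b \<Rightarrow> real) \<in> \<A>" if "(indicator X :: 'b \<Rightarrow> real) \<in> \<A>" for X
  proof -
    have "(\<lambda>x. 1 + (-1) * (indicator X x :: real)) \<in> \<A>" using const add mult that by blast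
    moreover have "(\<lambda>x. 1 + (-1) * (indicator X x :: real)) = indicator (UNIV - X)"
      by (auto simp: indicator_def)
    ultimately show ?thesis by simp
  qed
  have inter: "(indicator (X \<inter> Y) :: 'b \<Rightarrow> real) \<in> \<A>"
    if "(indicator X :: 'b \<Rightarrow> real) \<in> \<A>" "(indicator Y :: 'b \<Rightarrow> real) \<in> \<A>" for X Y
    using mult[OF that] by (simp add: indicator_inter_arith[symmetric])
  from A show ?thesis
  proof induction
    case (Basic a) then show ?case using gen by auto
  next
    case Empty then show ?case using const[of 0] by (simp add: indicator_def[abs_def])
  next
    case (Compl a) then show ?case using compl by blast
  next
    case (Union a)
    have fin: "(indicator (\<Union>i<n. a i) :: 'b \<Rightarrow> real) \<in> \<A>" for n :: nat
    proof (induction n)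
      case 0 then show ?case using const[of 0] by (simp add: indicator_def[abs_def])
    next
      case (Suc n)
      have "(\<Union>i<Suc n. a i) = UNIV - ((UNIV - (\<Union>i<n. a i)) \<inter> (UNIV - a n))"
        by (auto simp: lessThan_Suc)
      then show ?case using compl inter Suc Union.IH by presburger
    qed
    have "A' \<in> sets M" if "(indicator A' :: 'b \<Rightarrow> real) \<in> \<A>" for A'
      using meas[OF that] space by (simp add: borel_measurable_indicator_iff)
    then have "(indicator (\<Union>i. a i) :: 'b \<Rightarrow> real) \<in> borel_measurable M"
      using Union.IH by (intro borel_measurable_indicator sets.countable_nat_UN) auto
    then show ?case
      by (intro lim[OF fin, where B = 1]) (auto intro: LIMSEQ_indicator_UN simp del: indicator_simps indicator_UN_disjoint simp: indicator_le_1)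
  qed
qed

text \<open>
  The values of a homomorphism from the group \<open>range d\<close> to the unit circle, listed along the
  enumeration \<open>d\<close>. The set of all of them is a closed subgroup of a countable product of circles,
  so it is compact; this is what replaces the missing local compactness of the Hilbert space.
\<close>
definition characters :: "(nat \<Rightarrow> 'a::ab_group_add) \<Rightarrow> (nat \<Rightarrow> complex) set" where
  "characters d = {\<omega>. (\<forall>i. norm (\<omega> i) = 1) \<and> (\<forall>i j k. d k = d i + d j \<longrightarrow> \<omega> k = \<omega> i * \<omega> j)}"

locale enumerated_group =
  fixes d :: "nat \<Rightarrow> 'a::ab_group_add"
  assumes range_zero: "0 \<in> range d"
    and range_add: "\<And>i j. d i + d j \<in> range d"
    and range_uminus: "\<And>i. - d i \<in> range d"

lemma norm_character: "\<omega> \<in> characters d \<Longrightarrow> norm (\<omega> i) = 1"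
  by (simp add: characters_def)

lemma character_add: "\<omega> \<in> characters d \<Longrightarrow> d k = d i + d j \<Longrightarrow> \<omega> k = \<omega> i * \<omega> j"
  by (simp add: characters_def)

lemma character_zero:
  assumes "\<omega> \<in> characters d" "d k = 0" shows "\<omega> k = 1"
proof -
  have "\<omega> k = \<omega> k * \<omega> k" by (rule character_add[OF assms(1)]) (use assms in simp)
  moreover have "\<omega> k \<noteq> 0" using norm_character[OF assms(1), of k] by force
  ultimately show ?thesis by simp
qed

lemma character_uminus:
  assumes "\<omega> \<in> characters d" "d k = - d i" "0 \<in> range d" shows "\<omega> k = cnj (\<omega> i)"
proof -
  obtain z where z: "d z = 0" using assms(3) by auto
  have "\<omega> z = \<omega> k * \<omega> i" by (rule character_add[OF assms(1)]) (use assms z in simp)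
  then have 1: "\<omega> k * \<omega> i = 1" using character_zero[OF assms(1) z] by simp
  have "\<omega> i * cnj (\<omega> i) = 1" using norm_character[OF assms(1), of i]
    by (simp add: complex_norm_square[symmetric])
  then show ?thesis using 1 by (metis mult.assoc mult.commute mult.right_neutral)
qed

lemma measurable_coordinate [measurable]: "(\<lambda>\<omega>::nat \<Rightarrow> complex. \<omega> i) \<in> borel_measurable borel"
  by (intro borel_measurable_continuous_onI continuous_on_product_coordinates)

lemma measurable_cnj_coordinate [measurable]: "(\<lambda>\<omega>::nat \<Rightarrow> complex. cnj (\<omega> i)) \<in> borel_measurable borel"
  by (intro borel_measurable_continuous_onI continuous_on_cnj continuous_on_product_coordinates)

lemma closed_characters: "closed (characters d)"
proof -
  have "characters d = (\<Inter>i. {\<omega>. norm (\<omega> i) = 1}) \<inter>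
      (\<Inter>(i, j, k)\<in>{(i, j, k). d k = d i + d j}. {\<omega>. \<omega> k = \<omega> i * \<omega> j})"
    by (auto simp: characters_def)
  moreover have "closed \<dots>"
    by (intro closed_Int closed_INT ballI) (auto intro!: closed_Collect_eq continuous_intros)
  ultimately show ?thesis by simp
qed

lemma measurable_characters: "{\<omega> \<in> space borel. \<omega> \<in> characters d} \<in> sets borel"
  using borel_closed[OF closed_characters[of d]] by simp

text \<open>
  Trigonometric polynomials are combinations of products of evaluations \<open>\<omega> i\<close>, and on characters such a product is
  again a single evaluation because \<open>range d\<close> is a group. Hence the integrals of the evaluations
  determine those of all trigonometric polynomials, and by \<open>indicator_in_bounded_algebra\<close> the whole law.
\<close>
lemma (in enumerated_group) character_law_unique:
  assumes "prob_space Q1" "prob_space Q2"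
    and [measurable_cong]: "sets Q1 = sets borel" "sets Q2 = sets borel"
    and Q1: "AE \<omega> in Q1. \<omega> \<in> characters d" and Q2: "AE \<omega> in Q2. \<omega> \<in> characters d"
    and eq: "\<And>i. (\<integral>\<omega>. \<omega> i \<partial>Q1) = (\<integral>\<omega>. \<omega> i \<partial>Q2)"
  shows "Q1 = Q2"
proof -
  interpret Q1: prob_space Q1 by fact
  interpret Q2: prob_space Q2 by fact
  have [simp]: "space Q1 = UNIV" "space Q2 = UNIV"
    using sets_eq_imp_space_eq[OF assms(3)] sets_eq_imp_space_eq[OF assms(4)] by simp_all
  let ?G = "characters d"
  have nc: "norm (\<omega> i) = 1" if "\<omega> \<in> ?G" for \<omega> i using norm_character[OF that] .
  define bd where "bd f \<longleftrightarrow> (\<exists>B. \<forall>\<omega>\<in>?G. norm (f \<omega>) \<le> B)" for f :: "(nat \<Rightarrow> complex) \<Rightarrow> complex"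
  \<comment> \<open>\<open>V\<close> collects functions whose products with evaluations have equal integrals; \<open>\<A>\<close> consists of the
    multipliers of \<open>V\<close>. A set of multipliers is an algebra for free, and \<open>1 \<in> V\<close> turns
    \<open>indicator A \<in> \<A>\<close> into equality of the measures of \<open>A\<close>.\<close>
  define V where "V = {f \<in> borel_measurable borel. bd f \<and> (\<forall>i. (\<integral>\<omega>. f \<omega> * \<omega> i \<partial>Q1) = (\<integral>\<omega>. f \<omega> * \<omega> i \<partial>Q2))}"
  define \<A> where "\<A> = {g :: (nat \<Rightarrow> complex) \<Rightarrow> real. g \<in> borel_measurable borel \<and> (\<exists>B. \<forall>\<omega>\<in>?G. \<bar>g \<omega>\<bar> \<le> B) \<and>
      (\<forall>f\<in>V. (\<lambda>\<omega>. complex_of_real (g \<omega>) * f \<omega>) \<in> V)}"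
  have bdI: "bd f" if "\<And>\<omega>. \<omega> \<in> ?G \<Longrightarrow> norm (f \<omega>) \<le> B" for f B using that by (auto simp: bd_def)
  have int: "integrable Q f" if fm: "f \<in> borel_measurable borel" and fb: "bd f" and Q: "Q = Q1 \<or> Q = Q2" for f Q
  proof -
    obtain B where B: "\<And>\<omega>. \<omega> \<in> ?G \<Longrightarrow> norm (f \<omega>) \<le> B" using fb by (auto simp: bd_def)
    have m: "f \<in> borel_measurable Q1" "f \<in> borel_measurable Q2" using fm by (simp_all cong: measurable_cong_sets)
    show ?thesis
      using Q
    proof
      assume "Q = Q1" then show ?thesis
        using Q1 B by (auto intro!: Q1.integrable_const_bound[OF _ m(1), of B])
    next
      assume "Q = Q2" then show ?thesis
        using Q2 B by (auto intro!: Q2.integrable_const_bound[OF _ m(2), of B])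
    qed
  qed
  have bd_mult: "bd (\<lambda>\<omega>. f \<omega> * g \<omega>)" if "bd f" "bd g" for f g
  proof -
    obtain B C where "\<And>\<omega>. \<omega> \<in> ?G \<Longrightarrow> norm (f \<omega>) \<le> B" "\<And>\<omega>. \<omega> \<in> ?G \<Longrightarrow> norm (g \<omega>) \<le> C"
      using \<open>bd f\<close> \<open>bd g\<close> by (auto simp: bd_def)
    then have "norm (f \<omega> * g \<omega>) \<le> B * C" if "\<omega> \<in> ?G" for \<omega>
      using that mult_mono'[of "norm (f \<omega>)" B "norm (g \<omega>)" C] by (simp add: norm_mult)
    then show ?thesis by (rule bdI)
  qed
  have bd_add: "bd (\<lambda>\<omega>. f \<omega> + g \<omega>)" if "bd f" "bd g" for f g
  proof -
    obtain B C where "\<And>\<omega>. \<omega> \<in> ?G \<Longrightarrow> norm (f \<omega>) \<le> B" "\<And>\<omega>. \<omega> \<in> ?G \<Longrightarrow> norm (g \<omega>) \<le> C"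
      using \<open>bd f\<close> \<open>bd g\<close> by (auto simp: bd_def)
    then have "norm (f \<omega> + g \<omega>) \<le> B + C" if "\<omega> \<in> ?G" for \<omega>
      using that norm_triangle_mono by blast
    then show ?thesis by (rule bdI)
  qed
  have bd_coord: "bd (\<lambda>\<omega>. \<omega> i)" for i by (rule bdI[of _ 1]) (simp add: nc)
  have bd_of_real: "bd (\<lambda>\<omega>. complex_of_real (g \<omega>))" if "g \<in> \<A>" for g
    using that by (auto simp: \<A>_def bd_def)
  have V_add: "(\<lambda>\<omega>. f \<omega> + g \<omega>) \<in> V" if f: "f \<in> V" and g: "g \<in> V" for f g
  proof -
    have [measurable]: "f \<in> borel_measurable borel" "g \<in> borel_measurable borel" and b: "bd f" "bd g"
      using f g by (auto simp: V_def)
    have "integrable Q (\<lambda>\<omega>. f \<omega> * \<omega> i)" "integrable Q (\<lambda>\<omega>. g \<omega> * \<omega> i)" if "Q = Q1 \<or> Q = Q2" for Q i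
      using that b by (auto intro!: int bd_mult bd_coord)
    then show ?thesis using f g by (simp add: V_def bd_add distrib_right)
  qed
  have V_scale: "(\<lambda>\<omega>. c * f \<omega>) \<in> V" if f: "f \<in> V" for f c
  proof -
    have "bd (\<lambda>_. c)" by (rule bdI) auto
    then show ?thesis using f by (auto simp: V_def mult.assoc intro!: bd_mult)
  qed
  have V_coord: "(\<lambda>\<omega>. \<omega> j * f \<omega>) \<in> V" if f: "f \<in> V" for f j
  proof -
    have [measurable]: "f \<in> borel_measurable borel" and b: "bd f" using f by (auto simp: V_def)
    have "(\<integral>\<omega>. \<omega> j * f \<omega> * \<omega> i \<partial>Q1) = (\<integral>\<omega>. \<omega> j * f \<omega> * \<omega> i \<partial>Q2)" for i
    proof -
      obtain k where k: "d k = d j + d i" using range_add by (metis imageE)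
      have *: "\<omega> j * f \<omega> * \<omega> i = f \<omega> * \<omega> k" if "\<omega> \<in> ?G" for \<omega>
        using character_add[OF that k] by simp
      have "(\<integral>\<omega>. \<omega> j * f \<omega> * \<omega> i \<partial>Q1) = (\<integral>\<omega>. f \<omega> * \<omega> k \<partial>Q1)"
        by (rule integral_cong_AE, measurable, rule AE_mp[OF Q1], rule AE_I2) (simp add: *)
      also have "\<dots> = (\<integral>\<omega>. f \<omega> * \<omega> k \<partial>Q2)" using f by (simp add: V_def)
      also have "\<dots> = (\<integral>\<omega>. \<omega> j * f \<omega> * \<omega> i \<partial>Q2)"
        by (rule integral_cong_AE, measurable, rule AE_mp[OF Q2], rule AE_I2) (simp add: *)
      finally show ?thesis .
    qed
    then show ?thesis using b bd_coord by (auto simp: V_def intro: bd_mult)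
  qed
  have V_cnj: "(\<lambda>\<omega>. cnj (\<omega> j) * f \<omega>) \<in> V" if f: "f \<in> V" for f j
  proof -
    have [measurable]: "f \<in> borel_measurable borel" and b: "bd f" using f by (auto simp: V_def)
    obtain k where k: "d k = - d j" using range_uminus by (metis imageE)
    have *: "cnj (\<omega> j) = \<omega> k" if "\<omega> \<in> ?G" for \<omega>
      using character_uminus[OF that k range_zero] by simp
    have kV: "(\<lambda>\<omega>. \<omega> k * f \<omega>) \<in> V" using V_coord[OF f] .
    have "bd (\<lambda>\<omega>. cnj (\<omega> j) * f \<omega>)"
      using b by (intro bd_mult bdI[of "\<lambda>\<omega>. cnj (\<omega> j)" 1]) (auto simp: nc)
    moreover have "(\<integral>\<omega>. cnj (\<omega> j) * f \<omega> * \<omega> i \<partial>Q1) = (\<integral>\<omega>. cnj (\<omega> j) * f \<omega> * \<omega> i \<partial>Q2)" for i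
    proof -
      have "(\<integral>\<omega>. cnj (\<omega> j) * f \<omega> * \<omega> i \<partial>Q1) = (\<integral>\<omega>. \<omega> k * f \<omega> * \<omega> i \<partial>Q1)"
        by (rule integral_cong_AE, measurable, rule AE_mp[OF Q1], rule AE_I2) (simp add: *)
      also have "\<dots> = (\<integral>\<omega>. \<omega> k * f \<omega> * \<omega> i \<partial>Q2)" using kV by (simp add: V_def)
      also have "\<dots> = (\<integral>\<omega>. cnj (\<omega> j) * f \<omega> * \<omega> i \<partial>Q2)"
        by (rule integral_cong_AE, measurable, rule AE_mp[OF Q2], rule AE_I2) (simp add: *)
      finally show ?thesis .
    qed
    ultimately show ?thesis by (auto simp: V_def)
  qed
  have Re_A: "(\<lambda>\<omega>. Re (\<omega> j)) \<in> \<A>" for j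
  proof -
    have "(\<lambda>\<omega>. complex_of_real (Re (\<omega> j)) * f \<omega>) \<in> V" if "f \<in> V" for f
    proof -
      have "(\<lambda>\<omega>. (1/2) * (\<omega> j * f \<omega> + cnj (\<omega> j) * f \<omega>)) \<in> V"
        by (intro V_scale V_add V_coord V_cnj that)
      moreover have "(1/2) * (\<omega> j * f \<omega> + cnj (\<omega> j) * f \<omega>) = complex_of_real (Re (\<omega> j)) * f \<omega>" for \<omega>
        using complex_add_cnj[of "\<omega> j"] by (simp add: distrib_right[symmetric])
      ultimately show ?thesis by simp
    qed
    moreover have "\<exists>B. \<forall>\<omega>\<in>?G. \<bar>Re (\<omega> j)\<bar> \<le> B"
      using nc by (metis abs_Re_le_cmod)
    ultimately show ?thesis by (auto simp: \<A>_def)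
  qed
  have Im_A: "(\<lambda>\<omega>. Im (\<omega> j)) \<in> \<A>" for j
  proof -
    have "(\<lambda>\<omega>. complex_of_real (Im (\<omega> j)) * f \<omega>) \<in> V" if "f \<in> V" for f
    proof -
      have "(\<lambda>\<omega>. (- \<i>/2) * (\<omega> j * f \<omega> + (-1) * (cnj (\<omega> j) * f \<omega>))) \<in> V"
        by (intro V_scale V_add V_coord V_cnj that)
      moreover have "(- \<i>/2) * (\<omega> j * f \<omega> + (-1) * (cnj (\<omega> j) * f \<omega>)) = complex_of_real (Im (\<omega> j)) * f \<omega>" for \<omega>
        using complex_diff_cnj[of "\<omega> j"]
        by (simp add: left_diff_distrib[symmetric] mult.left_commute[of "\<i>" "complex_of_real _"])
      ultimately show ?thesis by simp
    qed
    moreover have "\<exists>B. \<forall>\<omega>\<in>?G. \<bar>Im (\<omega> j)\<bar> \<le> B"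
      using nc by (metis abs_Im_le_cmod)
    ultimately show ?thesis by (auto simp: \<A>_def)
  qed
  have A_bd: "\<exists>B. \<forall>\<omega>\<in>?G. \<bar>g \<omega>\<bar> \<le> B" if "g \<in> \<A>" for g using that by (auto simp: \<A>_def)
  have A_meas: "g \<in> borel_measurable borel" if "g \<in> \<A>" for g using that by (auto simp: \<A>_def)
  have ind: "(indicator A :: _ \<Rightarrow> real) \<in> \<A>" if "A \<in> sigma_sets UNIV {{x. c < f x} | f c. f \<in> \<A>}" for A
  proof (rule indicator_in_bounded_algebra[where M = borel and S = ?G, OF _ A_meas A_bd _ _ _ _ that])
    show "(\<lambda>_. c) \<in> \<A>" for c using V_scale by (auto simp: \<A>_def)
  next
    fix f g assume fg: "f \<in> \<A>" "g \<in> \<A>"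
    have "(\<lambda>\<omega>. complex_of_real (f \<omega> + g \<omega>) * h \<omega>) \<in> V" if "h \<in> V" for h
      using V_add[of "\<lambda>\<omega>. complex_of_real (f \<omega>) * h \<omega>" "\<lambda>\<omega>. complex_of_real (g \<omega>) * h \<omega>"] fg that
      by (simp add: \<A>_def distrib_right)
    moreover have "\<exists>B. \<forall>\<omega>\<in>?G. \<bar>f \<omega> + g \<omega>\<bar> \<le> B"
      using bd_add[OF bd_of_real[OF fg(1)] bd_of_real[OF fg(2)]] by (simp add: bd_def flip: of_real_add)
    ultimately show "(\<lambda>x. f x + g x) \<in> \<A>" using A_meas[OF fg(1)] A_meas[OF fg(2)] by (auto simp: \<A>_def)
    have "(\<lambda>\<omega>. complex_of_real (f \<omega> * g \<omega>) * h \<omega>) \<in> V" if "h \<in> V" for h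
    proof -
      have "(\<lambda>\<omega>. complex_of_real (f \<omega>) * (complex_of_real (g \<omega>) * h \<omega>)) \<in> V"
        using fg that by (simp add: \<A>_def)
      then show ?thesis by (simp add: mult.assoc)
    qed
    moreover have "\<exists>B. \<forall>\<omega>\<in>?G. \<bar>f \<omega> * g \<omega>\<bar> \<le> B"
      using bd_mult[OF bd_of_real[OF fg(1)] bd_of_real[OF fg(2)]] by (simp add: bd_def norm_mult abs_mult)
    ultimately show "(\<lambda>x. f x * g x) \<in> \<A>" using A_meas[OF fg(1)] A_meas[OF fg(2)] by (auto simp: \<A>_def)
  next
    fix F :: "nat \<Rightarrow> (nat \<Rightarrow> complex) \<Rightarrow> real" and f B
    assume F: "\<And>n. F n \<in> \<A>" and B: "\<And>n \<omega>. \<omega> \<in> ?G \<Longrightarrow> \<bar>F n \<omega>\<bar> \<le> B"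
      and [measurable]: "f \<in> borel_measurable borel" and l: "\<And>\<omega>. \<omega> \<in> ?G \<Longrightarrow> (\<lambda>n. F n \<omega>) \<longlonglongrightarrow> f \<omega>"
    have fB: "\<bar>f \<omega>\<bar> \<le> B" if "\<omega> \<in> ?G" for \<omega>
      using LIMSEQ_le_const2[OF tendsto_rabs[OF l[OF that]]] B[OF that] by auto
    have [measurable]: "F n \<in> borel_measurable borel" for n using A_meas F by auto
    have "(\<lambda>\<omega>. complex_of_real (f \<omega>) * h \<omega>) \<in> V" if h: "h \<in> V" for h
    proof -
      have [measurable]: "h \<in> borel_measurable borel" and "bd h" using h by (auto simp: V_def)
      obtain C where C: "\<And>\<omega>. \<omega> \<in> ?G \<Longrightarrow> norm (h \<omega>) \<le> C" using \<open>bd h\<close> by (auto simp: bd_def)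
      have b: "norm (complex_of_real (F n \<omega>) * h \<omega> * \<omega> i) \<le> B * C" if "\<omega> \<in> ?G" for n \<omega> i
        using mult_mono'[OF B[OF that, of n] C[OF that]] that by (simp add: norm_mult nc)
      have lm: "(\<lambda>n. complex_of_real (F n \<omega>) * h \<omega> * \<omega> i) \<longlonglongrightarrow> complex_of_real (f \<omega>) * h \<omega> * \<omega> i" if "\<omega> \<in> ?G" for \<omega> i
        by (intro tendsto_intros l that)
      have "(\<integral>\<omega>. complex_of_real (f \<omega>) * h \<omega> * \<omega> i \<partial>Q1) = (\<integral>\<omega>. complex_of_real (f \<omega>) * h \<omega> * \<omega> i \<partial>Q2)" for i
      proof -
        have "(\<lambda>n. \<integral>\<omega>. complex_of_real (F n \<omega>) * h \<omega> * \<omega> i \<partial>Q1) \<longlonglongrightarrow> (\<integral>\<omega>. complex_of_real (f \<omega>) * h \<omega> * \<omega> i \<partial>Q1)"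
          by (rule integral_dominated_convergence[where w = "\<lambda>_. B * C"]) (use Q1 lm b in auto)
        moreover have "(\<lambda>n. \<integral>\<omega>. complex_of_real (F n \<omega>) * h \<omega> * \<omega> i \<partial>Q2) \<longlonglongrightarrow> (\<integral>\<omega>. complex_of_real (f \<omega>) * h \<omega> * \<omega> i \<partial>Q2)"
          by (rule integral_dominated_convergence[where w = "\<lambda>_. B * C"]) (use Q2 lm b in auto)
        moreover have "(\<integral>\<omega>. complex_of_real (F n \<omega>) * h \<omega> * \<omega> i \<partial>Q1) = (\<integral>\<omega>. complex_of_real (F n \<omega>) * h \<omega> * \<omega> i \<partial>Q2)" for n
          using F[of n] h by (auto simp: \<A>_def V_def)
        ultimately show ?thesis using LIMSEQ_unique by simp
      qed
      moreover have "bd (\<lambda>\<omega>. complex_of_real (f \<omega>) * h \<omega>)"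
        using \<open>bd h\<close> fB by (intro bd_mult bdI[of "\<lambda>\<omega>. complex_of_real (f \<omega>)" B]) auto
      ultimately show ?thesis by (auto simp: V_def)
    qed
    then show "f \<in> \<A>" using fB by (auto simp: \<A>_def)
  qed simp_all
  have one_V: "(\<lambda>_. 1) \<in> V" using eq by (auto simp: V_def intro!: bdI[of _ 1])
  obtain z where z: "d z = 0" using range_zero by auto
  have char_z: "\<omega> z = 1" if "\<omega> \<in> ?G" for \<omega> using character_zero[of \<omega> d z] that z by simp
  show ?thesis
  proof (rule measure_eqI)
    fix A assume "A \<in> sets Q1"
    then have A [measurable]: "A \<in> sets borel" using assms(3) by simp
    let ?N = "sigma UNIV {{x. c < f x} | f c. f \<in> \<A>}"
    have gm: "f \<in> borel_measurable ?N" if "f \<in> \<A>" for f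
      unfolding borel_measurable_iff_greater using that by (auto intro!: sigma_sets.Basic)
    have "(\<lambda>\<omega>. \<omega> i) \<in> borel_measurable ?N" for i
      unfolding borel_measurable_complex_iff using gm[OF Re_A] gm[OF Im_A] by auto
    then have "(\<lambda>\<omega>. \<omega>) \<in> measurable ?N borel"
      by (intro measurable_coordinatewise_then_product)
    from measurable_sets[OF this A] have "A \<in> sigma_sets UNIV {{x. c < f x} | f c. f \<in> \<A>}"
      by simp
    from ind[OF this] one_V have "(\<lambda>\<omega>. complex_of_real (indicator A \<omega>) * 1) \<in> V"
      by (auto simp: \<A>_def)
    then have 1: "(\<integral>\<omega>. complex_of_real (indicator A \<omega>) * \<omega> z \<partial>Q1) = (\<integral>\<omega>. complex_of_real (indicator A \<omega>) * \<omega> z \<partial>Q2)"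
      by (simp add: V_def)
    have "(\<integral>\<omega>. complex_of_real (indicator A \<omega>) * \<omega> z \<partial>Q1) = (\<integral>\<omega>. complex_of_real (indicator A \<omega>) \<partial>Q1)"
      by (rule integral_cong_AE, measurable, rule AE_mp[OF Q1], rule AE_I2) (simp add: char_z)
    moreover have "(\<integral>\<omega>. complex_of_real (indicator A \<omega>) * \<omega> z \<partial>Q2) = (\<integral>\<omega>. complex_of_real (indicator A \<omega>) \<partial>Q2)"
      by (rule integral_cong_AE, measurable, rule AE_mp[OF Q2], rule AE_I2) (simp add: char_z)
    ultimately have "measure Q1 A = measure Q2 A"
      using 1 A assms(3,4) by simp
    then show "emeasure Q1 A = emeasure Q2 A"
      by (simp add: Q1.emeasure_eq_measure Q2.emeasure_eq_measure)
  qed (use assms in simp)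
qed

section \<open>Compactness of the laws on the group of characters\<close>

definition binary_digit :: "real \<Rightarrow> nat \<Rightarrow> real" where
  "binary_digit x k = real_of_int (\<lfloor>2 ^ Suc k * x\<rfloor> mod 2)"

lemma binary_digit_01: "binary_digit x k \<in> {0, 1}"
proof -
  have "\<lfloor>2 ^ Suc k * x\<rfloor> mod 2 = 0 \<or> \<lfloor>2 ^ Suc k * x\<rfloor> mod 2 = 1" by presburger
  then show ?thesis unfolding binary_digit_def by (metis insertCI of_int_0 of_int_1)
qed

lemma measurable_binary_digit [measurable]: "(\<lambda>x. binary_digit x k) \<in> borel_measurable borel"
  unfolding binary_digit_def by measurable

text \<open>
  The partial sums are \<open>\<lfloor>2 ^ n * x\<rfloor> / 2 ^ n\<close>.
\<close>
lemma binary_expansion: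
  assumes "0 \<le> x" "x < 1"
  shows "(\<lambda>k. binary_digit x k / 2 ^ Suc k) sums x"
proof -
  have partial: "(\<Sum>k<n. binary_digit x k / 2 ^ Suc k) = real_of_int \<lfloor>2 ^ n * x\<rfloor> / 2 ^ n" for n
  proof (induction n)
    case 0 then show ?case using assms by (simp add: floor_eq_iff)
  next
    case (Suc n)
    have "\<lfloor>2 ^ Suc n * x\<rfloor> div 2 = \<lfloor>2 ^ n * x\<rfloor>"
      using floor_divide_real_eq_div[of 2 "2 ^ Suc n * x"] by simp
    then have "\<lfloor>2 ^ Suc n * x\<rfloor> = 2 * \<lfloor>2 ^ n * x\<rfloor> + \<lfloor>2 ^ Suc n * x\<rfloor> mod 2"
      by (metis mult_div_mod_eq)
    then have "real_of_int \<lfloor>2 ^ Suc n * x\<rfloor> = 2 * real_of_int \<lfloor>2 ^ n * x\<rfloor> + binary_digit x n"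
      unfolding binary_digit_def by (metis of_int_add of_int_mult of_int_numeral)
    then show ?case using Suc by (simp add: field_simps)
  qed
  have "(\<lambda>n. real_of_int \<lfloor>2 ^ n * x\<rfloor> / 2 ^ n) \<longlonglongrightarrow> x"
  proof (rule LIM_zero_cancel, rule Lim_null_comparison)
    show "\<forall>\<^sub>F n in sequentially. norm (real_of_int \<lfloor>2 ^ n * x\<rfloor> / 2 ^ n - x) \<le> (1/2) ^ n"
    proof (intro always_eventually allI)
      fix n
      have "\<bar>real_of_int \<lfloor>2 ^ n * x\<rfloor> - 2 ^ n * x\<bar> \<le> 1" by linarith
      then have "\<bar>real_of_int \<lfloor>2 ^ n * x\<rfloor> - 2 ^ n * x\<bar> / 2 ^ n \<le> 1 / 2 ^ n"
        by (intro divide_right_mono) auto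
      moreover have "\<bar>real_of_int \<lfloor>2 ^ n * x\<rfloor> / 2 ^ n - x\<bar> = \<bar>real_of_int \<lfloor>2 ^ n * x\<rfloor> - 2 ^ n * x\<bar> / 2 ^ n"
        by (simp add: field_simps abs_divide[symmetric] del: abs_divide)
      ultimately show "norm (real_of_int \<lfloor>2 ^ n * x\<rfloor> / 2 ^ n - x) \<le> (1/2) ^ n"
        by (simp add: power_one_over)
    qed
  qed (simp add: LIMSEQ_power_zero)
  then show ?thesis unfolding sums_def partial .
qed

definition ternary :: "(nat \<Rightarrow> real) \<Rightarrow> real" where
  "ternary b = (\<Sum>m. 2 * b m / 3 ^ Suc m)"

text \<open>
  A continuous way to read a ternary digit. If \<open>t\<close> is a ternary expansion with digits 0 and 2, then
  \<open>3 ^ m * t\<close> is an even integer plus a number in \<open>[0, 1/3]\<close> or in \<open>[2/3, 1]\<close>. On the first interval the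
  cosine is at least \<open>1/2\<close>, on the second at most \<open>- 1/2\<close>, and truncation gives the digit exactly.
\<close>
definition read_digit :: "nat \<Rightarrow> real \<Rightarrow> real" where
  "read_digit m t = max 0 (min 1 (1/2 - cos (pi * (3 ^ m * t))))"

lemma read_digit_bounds: "0 \<le> read_digit m t" "read_digit m t \<le> 1"
  by (auto simp: read_digit_def)

lemma
  assumes b: "\<And>m. b m \<in> {0, 1::real}"
  shows summable_ternary: "summable (\<lambda>m. 2 * b m / 3 ^ Suc m)"
    and ternary_nonneg: "0 \<le> ternary b" and ternary_le_1: "ternary b \<le> 1"
proof -
  have b01: "0 \<le> b m" "b m \<le> 1" for m using b[of m] by auto
  have geo: "(\<lambda>m. 2/3 * (1/3) ^ m :: real) sums 1"
    using sums_mult[OF geometric_sums[of "1/3::real"], of "2/3"] by simp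
  have le: "2 * b m / 3 ^ Suc m \<le> 2/3 * (1/3) ^ m" for m
    using b01[of m] by (simp add: power_one_over divide_simps)
  show s: "summable (\<lambda>m. 2 * b m / 3 ^ Suc m)"
    by (rule summable_comparison_test'[OF sums_summable[OF geo]]) (use le b01 in auto)
  show "0 \<le> ternary b" unfolding ternary_def using s b01 by (intro suminf_nonneg) auto
  show "ternary b \<le> 1" unfolding ternary_def
    using suminf_le[OF le s sums_summable[OF geo]] sums_unique[OF geo] by simp
qed

lemma read_digit_ternary:
  assumes b: "\<And>m. b m \<in> {0, 1::real}"
  shows "read_digit m (ternary b) = b m"
proof -
  note sm = summable_ternary[of b, OF b]
  define r where "r = ternary (\<lambda>j. b (Suc m + j))"
  have r: "0 \<le> r" "r \<le> 1" unfolding r_def by (intro ternary_nonneg ternary_le_1 b)+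
  have "ternary b = (\<Sum>j. 2 * b (j + Suc m) / 3 ^ Suc (j + Suc m)) + (\<Sum>i<Suc m. 2 * b i / 3 ^ Suc i)"
    unfolding ternary_def by (rule suminf_split_initial_segment[OF sm])
  also have "(\<Sum>j. 2 * b (j + Suc m) / 3 ^ Suc (j + Suc m)) = r / 3 ^ Suc m"
  proof -
    have "(\<Sum>j. 2 * b (j + Suc m) / 3 ^ Suc (j + Suc m)) = (\<Sum>j. (2 * b (Suc m + j) / 3 ^ Suc j) / 3 ^ Suc m)"
      by (simp add: add.commute power_add field_simps)
    also have "\<dots> = r / 3 ^ Suc m"
      unfolding r_def ternary_def by (rule suminf_divide) (intro summable_ternary b)
    finally show ?thesis .
  qed
  finally have t: "3 ^ m * ternary b = r / 3 + 2 * b m / 3 + (\<Sum>i<m. 3 ^ m * (2 * b i / 3 ^ Suc i))"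
    by (simp add: distrib_left sum_distrib_left)
  have "\<exists>N::int. (\<Sum>i<m. 3 ^ m * (2 * b i / 3 ^ Suc i)) = 2 * real_of_int N"
  proof (intro exI)
    have "3 ^ m * (2 * b i / 3 ^ Suc i) = 2 * real_of_int (\<lfloor>b i\<rfloor> * 3 ^ (m - Suc i))" if "i < m" for i
    proof -
      have "(3::real) ^ m = 3 ^ (m - Suc i) * 3 ^ Suc i" using that by (simp del: power_Suc flip: power_add)
      moreover have "real_of_int \<lfloor>b i\<rfloor> = b i" using b[of i] by (elim insertE) auto
      ultimately show ?thesis by (simp only: of_int_mult of_int_power of_int_numeral) simp
    qed
    then show "(\<Sum>i<m. 3 ^ m * (2 * b i / 3 ^ Suc i)) = 2 * real_of_int (\<Sum>i<m. \<lfloor>b i\<rfloor> * 3 ^ (m - Suc i))"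
      by (simp add: sum_distrib_left)
  qed
  then obtain N where "3 ^ m * ternary b = r / 3 + 2 * b m / 3 + 2 * real_of_int N" using t by auto
  then have "cos (pi * (3 ^ m * ternary b)) = cos (pi * (r / 3 + 2 * b m / 3) + 2 * pi * real_of_int N)"
    by (simp add: algebra_simps)
  also have "\<dots> = cos (pi * (r / 3 + 2 * b m / 3))"
    by (simp add: cos_add sin_int_2pin cos_int_2pin)
  finally have c: "cos (pi * (3 ^ m * ternary b)) = cos (pi * (r / 3 + 2 * b m / 3))" .
  consider "b m = 0" | "b m = 1" using b[of m] by auto
  then show ?thesis
  proof cases
    case 1
    have "cos (pi / 3) \<le> cos (pi * (r / 3))"
      using r by (intro cos_monotone_0_pi_le) (auto simp: field_simps intro: order_trans[OF mult_left_mono])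
    then show ?thesis using 1 c by (simp add: read_digit_def cos_60)
  next
    case 2
    have "cos (pi * (r / 3 + 2 / 3)) \<le> cos (2 * pi / 3)"
      using r by (intro cos_monotone_0_pi_le) (auto simp: field_simps intro: order_trans[OF mult_left_mono])
    moreover have "cos (2 * pi / 3) = - 1 / 2" by (simp add: cos_120)
    ultimately show ?thesis using 2 c by (simp add: read_digit_def)
  qed
qed

text \<open>
  The sequence \<open>circle_point i t\<close>, \<open>i \<in> \<nat>\<close>, is a space-filling curve in the manner of Schoenberg: it depends
  continuously on the real parameter \<open>t\<close>, and every sequence of points of the circle arises from some
  \<open>t\<close>, for instance from its \<open>encode\<close>. Digit \<open>k\<close> of coordinate \<open>i\<close> is stored in position
  \<open>prod_encode (i, k)\<close>.
\<close>
definition circle_point :: "nat \<Rightarrow> real \<Rightarrow> complex" where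
  "circle_point i t = cis (2 * pi * (\<Sum>k. read_digit (prod_encode (i, k)) t / 2 ^ Suc k))"

text \<open>
  The angle in \<open>[0, 1)\<close>, as a fraction of a full turn. The truncation of the real part keeps the argument
  of the arc cosine in its domain, so that measurability needs no case distinction.
\<close>
definition turn :: "complex \<Rightarrow> real" where
  "turn z = frac ((if 0 \<le> Im z then 1 else - 1) * arccos (max (- 1) (min 1 (Re z))) / (2 * pi))"

definition encode :: "(nat \<Rightarrow> complex) \<Rightarrow> real" where
  "encode \<omega> = ternary (\<lambda>m. case prod_decode m of (i, k) \<Rightarrow> binary_digit (turn (\<omega> i)) k)"

lemma continuous_circle_point: "continuous_on UNIV (circle_point i)"
proof -
  have "continuous_on UNIV (\<lambda>t. \<Sum>k. read_digit (prod_encode (i, k)) t / 2 ^ Suc k)"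
  proof (rule uniform_limit_theorem)
    have half: "summable (\<lambda>k. 1 / 2 ^ Suc k :: real)"
      using sums_summable[OF power_half_series] by (simp add: power_one_over)
    show "uniform_limit UNIV (\<lambda>n t. \<Sum>k<n. read_digit (prod_encode (i, k)) t / 2 ^ Suc k)
        (\<lambda>t. \<Sum>k. read_digit (prod_encode (i, k)) t / 2 ^ Suc k) sequentially"
      by (rule Weierstrass_m_test[OF _ half]) (use read_digit_bounds in \<open>auto intro!: divide_right_mono\<close>)
    show "\<forall>\<^sub>F n in sequentially. continuous_on UNIV (\<lambda>t. \<Sum>k<n. read_digit (prod_encode (i, k)) t / 2 ^ Suc k)"
      unfolding read_digit_def by (intro always_eventually allI continuous_intros) auto
  qed simp
  then show ?thesis unfolding circle_point_def by (intro continuous_intros)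
qed

lemma norm_circle_point: "norm (circle_point i t) = 1"
  by (simp add: circle_point_def)

lemma turn_bounds: "0 \<le> turn z" "turn z < 1"
  by (auto simp: turn_def frac_lt_1)

lemma cis_turn:
  assumes "norm z = 1" shows "cis (2 * pi * turn z) = z"
proof -
  define a where "a = arccos (max (- 1) (min 1 (Re z)))"
  define \<theta> where "\<theta> = (if 0 \<le> Im z then a else - a)"
  have "\<bar>Re z\<bar> \<le> 1" using abs_Re_le_cmod[of z] assms by simp
  then have Re: "- 1 \<le> Re z" "Re z \<le> 1" by auto
  have sq: "(Re z)\<^sup>2 + (Im z)\<^sup>2 = 1" using assms cmod_power2[of z] by simp
  then have "1 - (Re z)\<^sup>2 = (Im z)\<^sup>2" by simp
  then have "cos a = Re z" "sin a = \<bar>Im z\<bar>"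
    using Re by (simp_all add: a_def cos_arccos sin_arccos max_def min_def)
  then have cis: "cis \<theta> = z" by (auto simp: \<theta>_def complex_eq_iff)
  have "2 * pi * turn z = \<theta> - 2 * pi * real_of_int \<lfloor>\<theta> / (2 * pi)\<rfloor>"
    by (simp add: turn_def frac_def right_diff_distrib a_def \<theta>_def)
  then have "cis (2 * pi * turn z) = cis \<theta> / cis (2 * pi * real_of_int \<lfloor>\<theta> / (2 * pi)\<rfloor>)"
    by (simp only: cis_divide)
  then show ?thesis by (simp add: cis cis_multiple_2pi)
qed

lemma measurable_turn [measurable]: "turn \<in> borel_measurable borel"
proof -
  have "continuous_on UNIV (\<lambda>z::complex. arccos (max (- 1) (min 1 (Re z))))"
    by (intro continuous_on_arccos continuous_intros) auto
  then have [measurable]: "(\<lambda>z::complex. arccos (max (- 1) (min 1 (Re z)))) \<in> borel_measurable borel"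
    by (rule borel_measurable_continuous_onI)
  show ?thesis unfolding turn_def[abs_def] frac_def by measurable
qed

lemma encode_digits: "(case prod_decode m of (i, k) \<Rightarrow> binary_digit (turn (\<omega> i)) k) \<in> {0, 1}"
  by (cases "prod_decode m") (metis binary_digit_01 case_prod_conv)

lemma measurable_encode [measurable]: "encode \<in> borel_measurable borel"
proof -
  have "(\<lambda>\<omega>. turn (\<omega> i)) \<in> borel_measurable borel" for i
    by measurable
  then have "(\<lambda>\<omega>. binary_digit (turn (\<omega> i)) k) \<in> borel_measurable borel" for i k
    by measurable
  then have "(\<lambda>\<omega>. case prod_decode m of (i, k) \<Rightarrow> binary_digit (turn (\<omega> i)) k) \<in> borel_measurable borel" for m
    by (cases "prod_decode m") auto
  then show ?thesis unfolding encode_def[abs_def] ternary_def by measurable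
qed

lemma encode_bounds: "0 \<le> encode \<omega>" "encode \<omega> \<le> 1"
  unfolding encode_def by (intro ternary_nonneg ternary_le_1 encode_digits)+

lemma circle_point_encode:
  assumes "norm (\<omega> i) = 1" shows "circle_point i (encode \<omega>) = \<omega> i"
proof -
  have "read_digit (prod_encode (i, k)) (encode \<omega>) = binary_digit (turn (\<omega> i)) k" for k
    unfolding encode_def by (subst read_digit_ternary[OF encode_digits]) simp
  then have "(\<Sum>k. read_digit (prod_encode (i, k)) (encode \<omega>) / 2 ^ Suc k) = turn (\<omega> i)"
    using sums_unique[OF binary_expansion[OF turn_bounds]] by simp
  then show ?thesis using cis_turn[OF assms] by (simp add: circle_point_def)
qed

text \<open>
  A sequential compactness theorem for laws on the compact group of characters. The encoding moves the laws
  to \<open>[0, 1]\<close>, where Helly's selection theorem applies, and the continuous decoding brings the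
  limit back; the coordinates converge in mean because each is a bounded continuous function of the code.
\<close>
lemma character_laws_compact:
  fixes Q :: "nat \<Rightarrow> (nat \<Rightarrow> complex) measure" and d :: "nat \<Rightarrow> 'a::ab_group_add"
  assumes prob: "\<And>n. prob_space (Q n)" and sets: "\<And>n. sets (Q n) = sets borel"
    and chars: "\<And>n. AE \<omega> in Q n. \<omega> \<in> characters d"
  obtains s Q' where "strict_mono (s :: nat \<Rightarrow> nat)" "prob_space Q'" "sets Q' = sets borel"
    "AE \<omega> in Q'. \<omega> \<in> characters d"
    "\<And>i. (\<lambda>n. \<integral>\<omega>. \<omega> i \<partial>Q (s n)) \<longlonglongrightarrow> (\<integral>\<omega>. \<omega> i \<partial>Q')"
proof -
  note sets [measurable_cong]
  have em: "encode \<in> borel_measurable (Q n)" for n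
    using measurable_encode sets[of n] by (simp cong: measurable_cong_sets)
  define P where "P n = distr (Q n) borel encode" for n
  have P: "real_distribution (P n)" for n
    unfolding P_def using prob_space.real_distribution_distr[OF prob em] .
  have "tight P"
    unfolding tight_def
  proof (intro conjI allI impI P)
    fix \<epsilon> :: real assume "\<epsilon> > 0"
    have "measure (P n) {-1<..1} = 1" for n
    proof -
      interpret prob_space "Q n" by (rule prob)
      have "measure (P n) {-1<..1} = prob (space (Q n))"
      proof -
        have "encode -` {-1<..1} = UNIV"
          using order.strict_trans2[OF _ encode_bounds(1), of "-1"] encode_bounds(2) by auto
        then show ?thesis unfolding P_def by (subst measure_distr[OF em]) auto
      qed
      then show ?thesis by (simp add: prob_space)
    qed
    then show "\<exists>a b. a < b \<and> (\<forall>n. measure (P n) {a<..b} > 1 - \<epsilon>)"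
      using \<open>\<epsilon> > 0\<close> by (intro exI[of _ "-1"] exI[of _ 1]) auto
  qed
  from tight_imp_convergent_subsubsequence[OF this strict_mono_id] obtain s M
    where s: "strict_mono (s :: nat \<Rightarrow> nat)" and M: "real_distribution M" and wc: "weak_conv_m (P \<circ> id \<circ> s) M" by blast
  interpret M: real_distribution M by fact
  have conv: "(\<lambda>n. \<integral>t. f t \<partial>P (s n)) \<longlonglongrightarrow> (\<integral>t. f t \<partial>M)"
    if "continuous_on UNIV f" "\<And>t. norm (f t) \<le> B" for f :: "real \<Rightarrow> complex" and B
    using weak_conv_imp_integral_bdd_continuous_conv[OF _ M wc, of f B] P that
    by (simp add: continuous_on_eq_continuous_at)
  have cm [measurable]: "circle_point i \<in> borel_measurable borel" for i
    by (rule borel_measurable_continuous_onI[OF continuous_circle_point])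
  have vm: "(\<lambda>t i. circle_point i t) \<in> measurable borel borel"
    by (rule measurable_coordinatewise_then_product) measurable
  then have vM: "(\<lambda>t i. circle_point i t) \<in> measurable M borel" by simp
  define Q' where "Q' = distr M borel (\<lambda>t i. circle_point i t)"
  have PQ: "(\<integral>t. f t \<partial>P n) = (\<integral>\<omega>. f (encode \<omega>) \<partial>Q n)" if "f \<in> borel_measurable borel" for f :: "real \<Rightarrow> complex" and n
    unfolding P_def by (rule integral_distr[OF em that])
  have dec: "AE \<omega> in Q n. circle_point i (encode \<omega>) = \<omega> i" for n i
    using chars by eventually_elim (simp add: circle_point_encode norm_character)
  have cong: "measurable (Q n) borel = measurable borel borel" for n
    using sets by (simp cong: measurable_cong_sets)
  show ?thesis
  proof
    show "strict_mono s" by fact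
    show "prob_space Q'" unfolding Q'_def by (rule M.prob_space_distr[OF vM])
    show "sets Q' = sets borel" by (simp add: Q'_def)
    show "(\<lambda>n. \<integral>\<omega>. \<omega> i \<partial>Q (s n)) \<longlonglongrightarrow> (\<integral>\<omega>. \<omega> i \<partial>Q')" for i
    proof -
      have "(\<integral>t. circle_point i t \<partial>P n) = (\<integral>\<omega>. \<omega> i \<partial>Q n)" for n
        unfolding PQ[OF cm] by (rule integral_cong_AE, measurable) (rule dec)
      moreover have "(\<integral>\<omega>. \<omega> i \<partial>Q') = (\<integral>t. circle_point i t \<partial>M)"
        unfolding Q'_def by (rule integral_distr[OF vM]) measurable
      ultimately show ?thesis
        using conv[of "circle_point i" 1, OF continuous_circle_point] by (simp add: norm_circle_point)
    qed
    \<comment> \<open>Multiplicativity survives the limit because it says that a bounded continuous function,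
      the squared defect, has integral zero.\<close>
    have "AE t in M. circle_point k t = circle_point i t * circle_point j t" if k: "d k = d i + d j" for i j k
    proof -
      define g where "g t = complex_of_real ((norm (circle_point k t - circle_point i t * circle_point j t))\<^sup>2)" for t
      have gc: "continuous_on UNIV g" unfolding g_def
        by (intro continuous_intros continuous_circle_point)
      then have [measurable]: "g \<in> borel_measurable borel" by (rule borel_measurable_continuous_onI)
      have gb: "norm (g t) \<le> 4" for t
      proof -
        have "norm (circle_point k t - circle_point i t * circle_point j t) \<le> 2"
          by (rule order_trans[OF norm_triangle_ineq4]) (simp add: norm_mult norm_circle_point)
        from power_mono[OF this, of 2] show ?thesis by (simp add: g_def norm_power)
      qed
      have "(\<integral>t. g t \<partial>P n) = (\<integral>\<omega>. 0 \<partial>Q n)" for n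
        unfolding PQ[OF \<open>g \<in> _\<close>]
      proof (rule integral_cong_AE)
        show "AE \<omega> in Q n. g (encode \<omega>) = 0"
          using chars[of n] dec[of i n] dec[of j n] dec[of k n]
          by eventually_elim (simp add: g_def character_add[OF _ k])
      qed (auto simp: cong)
      then have "(\<lambda>_. 0) \<longlonglongrightarrow> (\<integral>t. g t \<partial>M)" using conv[OF gc gb] by simp
      then have "(\<integral>t. g t \<partial>M) = 0" using LIMSEQ_unique[OF _ tendsto_const] by blast
      then have "(\<integral>t. (norm (circle_point k t - circle_point i t * circle_point j t))\<^sup>2 \<partial>M) = 0"
        unfolding g_def by (simp flip: of_real_power)
      moreover have "integrable M (\<lambda>t. (norm (circle_point k t - circle_point i t * circle_point j t))\<^sup>2)"
        by (rule M.integrable_const_bound[of _ 4]) (use gb in \<open>auto simp: g_def norm_power\<close>)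
      ultimately show ?thesis
        by (subst (asm) integral_nonneg_eq_0_iff_AE) auto
    qed
    then have "AE t in M. \<forall>i j k. d k = d i + d j \<longrightarrow> circle_point k t = circle_point i t * circle_point j t"
      by (simp add: AE_all_countable)
    then have "AE t in M. (\<lambda>i. circle_point i t) \<in> characters d"
      by eventually_elim (auto simp: characters_def norm_circle_point)
    then show "AE \<omega> in Q'. \<omega> \<in> characters d"
      unfolding Q'_def by (subst AE_distr_iff[OF vM measurable_characters])
  qed
qed

section \<open>Characteristic functions\<close>

abbreviation borel_prob :: "'a::topological_space measure \<Rightarrow> bool" where
  "borel_prob M \<equiv> prob_space M \<and> sets M = sets borel"

definition hchar :: "'a::real_inner measure \<Rightarrow> 'a \<Rightarrow> complex" where
  "hchar M h = (\<integral>x. cis (x \<bullet> h) \<partial>M)"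

lemma measurable_cis_inner [measurable]: "(\<lambda>x::'a::real_inner. cis (x \<bullet> h)) \<in> borel_measurable borel"
  by (intro borel_measurable_continuous_onI continuous_intros)

lemma space_borel_prob: "borel_prob M \<Longrightarrow> space M = UNIV"
  using sets_eq_imp_space_eq[of M borel] by simp

lemma borel_prob_distr:
  assumes "borel_prob M" "f \<in> measurable borel borel"
  shows "borel_prob (distr M borel f)"
  using assms prob_space.prob_space_distr[of M f borel] by (simp cong: measurable_cong_sets)

lemma hchar_distr:
  assumes "sets M = sets borel" "f \<in> measurable borel borel"
  shows "hchar (distr M borel f) h = (\<integral>x. cis (f x \<bullet> h) \<partial>M)"
  unfolding hchar_def by (rule integral_distr) (use assms in \<open>simp_all cong: measurable_cong_sets\<close>)

lemma integrable_cis: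
  assumes "borel_prob M" "f \<in> borel_measurable borel"
  shows "integrable M (\<lambda>x. cis (f x))"
proof -
  interpret prob_space M using assms by simp
  have [measurable]: "f \<in> borel_measurable M" using assms by (simp cong: measurable_cong_sets)
  have "cis \<in> borel_measurable borel" by (intro borel_measurable_continuous_onI continuous_intros)
  then show ?thesis by (intro integrable_const_bound[of _ 1]) auto
qed

lemma measurable_inner_borel [measurable]: "(\<lambda>x::'a::real_inner. x \<bullet> h) \<in> borel_measurable borel"
  by (intro borel_measurable_continuous_onI continuous_intros)

lemma hchar_zero: "borel_prob M \<Longrightarrow> hchar M 0 = 1"
  by (simp add: hchar_def prob_space.prob_space)

lemma norm_hchar_le_1: "borel_prob M \<Longrightarrow> norm (hchar M h) \<le> 1"
proof -
  assume M: "borel_prob M"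
  have "norm (hchar M h) \<le> (\<integral>x. norm (cis (x \<bullet> h)) \<partial>M)" unfolding hchar_def by (rule integral_norm_bound)
  then show ?thesis using M by (simp add: prob_space.prob_space)
qed

lemma hchar_translate:
  fixes a :: "'a::real_inner"
  assumes "borel_prob M"
  shows "hchar (distr M borel (\<lambda>x. x + a)) h = cis (a \<bullet> h) * hchar M h"
proof -
  have "(\<lambda>x. x + a) \<in> measurable borel borel"
    by (intro borel_measurable_continuous_onI continuous_intros)
  then have "hchar (distr M borel (\<lambda>x. x + a)) h = (\<integral>x. cis (a \<bullet> h) * cis (x \<bullet> h) \<partial>M)"
    using assms by (subst hchar_distr) (auto simp: inner_add_left cis_mult add.commute)
  then show ?thesis by (simp add: hchar_def)
qed

lemma borel_prob_pair:
  fixes M N :: "'a::second_countable_topology measure"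
  assumes "borel_prob M" "borel_prob N" shows "borel_prob (M \<Otimes>\<^sub>M N)"
proof -
  interpret M: prob_space M using assms by simp
  interpret N: prob_space N using assms by simp
  interpret pair_prob_space M N ..
  have "sets (M \<Otimes>\<^sub>M N) = sets (borel :: ('a \<times> 'a) measure)"
    unfolding borel_prod[symmetric] using assms by (intro sets_pair_measure_cong) auto
  then show ?thesis using prob_space_axioms by blast
qed

lemma borel_prob_measure_conv:
  fixes M N :: "'a::{real_normed_vector, second_countable_topology} measure"
  assumes "borel_prob M" "borel_prob N" shows "borel_prob (measure_conv M N)"
  unfolding measure_conv_def
proof (rule borel_prob_distr[OF borel_prob_pair[OF assms]])
  show "(\<lambda>(x::'a, y). x + y) \<in> borel_measurable borel"
    unfolding split_beta by (intro borel_measurable_continuous_onI continuous_intros)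
qed

lemma integral_pair_mult:
  fixes f :: "'a \<Rightarrow> complex" and g :: "'b \<Rightarrow> complex"
  assumes "sigma_finite_measure M" "sigma_finite_measure N"
    and f: "integrable M f" and g: "integrable N g"
  shows "(\<integral>z. f (fst z) * g (snd z) \<partial>(M \<Otimes>\<^sub>M N)) = (\<integral>x. f x \<partial>M) * (\<integral>y. g y \<partial>N)"
proof -
  interpret P: pair_sigma_finite M N using assms by (simp add: pair_sigma_finite_def)
  have [measurable]: "f \<in> borel_measurable M" "g \<in> borel_measurable N" using f g by auto
  have "integrable (M \<Otimes>\<^sub>M N) (\<lambda>z. f (fst z) * g (snd z))"
  proof (rule P.Fubini_integrable)
    show "integrable M (\<lambda>x. \<integral>y. norm (f (fst (x, y)) * g (snd (x, y))) \<partial>N)"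
      using f by (simp add: norm_mult)
  qed (use g in auto)
  from P.integral_fst'[OF this] show ?thesis by simp
qed

text \<open>
  Stated for an additive \<open>g\<close> rather than an inner product, so that it also applies to \<open>g x = A x \<bullet> h\<close>
  with a bounded operator \<open>A\<close>, without passing to its adjoint.
\<close>
lemma integral_cis_measure_conv:
  fixes M N :: "'a::{real_normed_vector, second_countable_topology} measure"
  assumes M: "borel_prob M" and N: "borel_prob N"
    and g: "g \<in> borel_measurable borel" and add: "\<And>x y. g (x + y) = g x + g y"
  shows "(\<integral>z. cis (g z) \<partial>measure_conv M N) = (\<integral>x. cis (g x) \<partial>M) * (\<integral>y. cis (g y) \<partial>N)"
proof -
  have "(\<lambda>(x::'a, y). x + y) \<in> borel_measurable borel"
    unfolding split_beta by (intro borel_measurable_continuous_onI continuous_intros)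
  then have m: "(\<lambda>(x, y). x + y) \<in> measurable (M \<Otimes>\<^sub>M N) borel"
    using borel_prob_pair[OF M N] by (simp cong: measurable_cong_sets)
  have "cis \<in> borel_measurable borel" by (intro borel_measurable_continuous_onI continuous_intros)
  from measurable_compose[OF g this]
  have "(\<integral>z. cis (g z) \<partial>measure_conv M N) = (\<integral>z. cis (g (case z of (x, y) \<Rightarrow> x + y)) \<partial>(M \<Otimes>\<^sub>M N))"
    unfolding measure_conv_def by (rule integral_distr[OF m])
  also have "\<dots> = (\<integral>z. cis (g (fst z)) * cis (g (snd z)) \<partial>(M \<Otimes>\<^sub>M N))"
    by (simp add: split_beta add cis_mult)
  also have "\<dots> = (\<integral>x. cis (g x) \<partial>M) * (\<integral>y. cis (g y) \<partial>N)"
    by (intro integral_pair_mult integrable_cis prob_space_imp_sigma_finite g) (use M N in auto)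
  finally show ?thesis .
qed

lemma hchar_measure_conv:
  fixes M N :: "'a::{real_inner, second_countable_topology} measure"
  assumes "borel_prob M" "borel_prob N"
  shows "hchar (measure_conv M N) h = hchar M h * hchar N h"
  unfolding hchar_def
  by (rule integral_cis_measure_conv[OF assms measurable_inner_borel]) (rule inner_add_left)

lemma borel_prob_return: "borel_prob (return borel a)"
  by (simp add: prob_space_return)

lemma borel_prob_conv_power:
  fixes M :: "'a::{real_normed_vector, second_countable_topology} measure"
  assumes "borel_prob M" shows "borel_prob (measure_conv_power n M)"
proof (induction n)
  case 0 then show ?case unfolding measure_conv_power.simps by (rule borel_prob_return)
next
  case (Suc n) then show ?case unfolding measure_conv_power.simps by (rule borel_prob_measure_conv[OF assms])
qed

lemma hchar_conv_power:
  fixes M :: "'a::{real_inner, second_countable_topology} measure"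
  assumes "borel_prob M" shows "hchar (measure_conv_power n M) h = hchar M h ^ n"
proof (induction n)
  case 0 then show ?case by (simp add: hchar_def integral_return)
next
  case (Suc n) then show ?case
    using hchar_measure_conv[OF assms borel_prob_conv_power[OF assms]] by simp
qed

section \<open>The Hilbert space inside the group of characters\<close>

text \<open>
  Ulam's theorem: inner regularity by compact sets on a Polish space.
\<close>
lemma sigma_compact_support:
  fixes M :: "'a::polish_space measure"
  assumes M: "borel_prob M"
  obtains K :: "nat \<Rightarrow> 'a set" where "\<And>m. compact (K m)" "AE x in M. x \<in> (\<Union>m. K m)"
proof -
  interpret prob_space M using M by simp
  have sp: "space M = UNIV" using space_borel_prob[OF M] .
  have sup: "(SUP K\<in>{K. K \<subseteq> UNIV \<and> compact K}. emeasure M K) = 1"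
    using inner_regular[of M UNIV] M emeasure_space_1 sp by simp
  have "\<exists>K. compact K \<and> emeasure M K > 1 - 1 / ennreal (Suc m)" for m
  proof -
    have "1 - 1 / ennreal (Suc m) < (1::ennreal)"
      by (intro ennreal_between) (auto simp: ennreal_divide_eq_0_iff ennreal_zero_less_divide)
    then show ?thesis unfolding sup[symmetric] less_SUP_iff by auto
  qed
  then obtain K where K: "\<And>m. compact (K m)" and big: "\<And>m. emeasure M (K m) > 1 - 1 / ennreal (Suc m)" by metis
  have Km: "K m \<in> sets M" for m using compact_imp_closed[OF K] M by auto
  have ge: "prob (\<Union>m. K m) \<ge> 1 - 1 / real (Suc m)" for m
  proof -
    have "ennreal (1 - 1 / real (Suc m)) = 1 - 1 / ennreal (Suc m)"
      by (subst ennreal_minus[symmetric]) (auto simp: divide_ennreal[symmetric] simp flip: ennreal_1)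
    then have "ennreal (1 - 1 / real (Suc m)) < ennreal (prob (K m))"
      using big[of m] by (simp add: emeasure_eq_measure)
    then have "1 - 1 / real (Suc m) \<le> prob (K m)" by (simp add: ennreal_less_iff)
    also have "\<dots> \<le> prob (\<Union>m. K m)" using Km by (intro finite_measure_mono) auto
    finally show ?thesis .
  qed
  have "1 \<le> prob (\<Union>m. K m)"
  proof (rule field_le_epsilon)
    fix e :: real assume "e > 0"
    then obtain m where "inverse (real (Suc m)) < e" using reals_Archimedean by blast
    then show "1 \<le> prob (\<Union>m. K m) + e" using ge[of m] by (simp add: inverse_eq_divide del: of_nat_Suc)
  qed
  then have "prob (\<Union>m. K m) = 1" using prob_le_1[of "\<Union>m. K m"] by linarith
  then have "AE x in M. x \<in> (\<Union>m. K m)" using prob_eq_1[OF sets.countable_nat_UN[of K M]] Km by auto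
  then show ?thesis using that K by blast
qed

text \<open>
  A countable group of frequencies, in place of all vectors of the space. Divisibility makes it possible to
  recover \<open>x \<bullet> h\<close> from the angles \<open>cis (x \<bullet> h)\<close>, which alone determine it only up to multiples of \<open>2 * pi\<close>, and
  to recover a character from its \<open>n\<close>-th power.
\<close>
locale frequency_group = enumerated_group d for d :: "nat \<Rightarrow> 'a::{real_inner, polish_space}" +
  assumes divisible: "\<And>i n. n \<ge> 1 \<Longrightarrow> \<exists>k. d i = real n *\<^sub>R d k"
    and separating: "\<And>x. (\<And>i. x \<bullet> d i = 0) \<Longrightarrow> x = 0"
begin

definition embed :: "'a \<Rightarrow> nat \<Rightarrow> complex" where
  "embed x i = cis (x \<bullet> d i)"

lemma continuous_embed: "continuous_on S embed"
  unfolding embed_def[abs_def] by (intro continuous_on_coordinatewise_then_product continuous_intros)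

lemma measurable_embed [measurable]: "embed \<in> measurable borel borel"
  by (rule borel_measurable_continuous_onI[OF continuous_embed])

lemma embed_in_characters: "embed x \<in> characters d"
  by (simp add: characters_def embed_def inner_add_right cis_mult)

lemma embed_add: "embed (x + y) i = embed x i * embed y i"
  by (simp add: embed_def inner_add_left cis_mult)

text \<open>
  Dividing the frequency by a large integer makes the angle smaller than a full turn.
\<close>
lemma inj_embed: "inj embed"
proof (rule injI)
  fix x y assume xy: "embed x = embed y"
  have "(x - y) \<bullet> d i = 0" for i
  proof -
    obtain n :: nat where n: "\<bar>(x - y) \<bullet> d i\<bar> < real n" using reals_Archimedean2 by blast
    then have n1: "n \<ge> 1" by (cases n) auto
    then obtain k where k: "d i = real n *\<^sub>R d k" using divisible by blast
    define \<theta> where "\<theta> = (x - y) \<bullet> d k"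
    have "real n * \<bar>\<theta>\<bar> < real n * 1" using n k by (simp add: \<theta>_def abs_mult)
    then have small: "\<bar>\<theta>\<bar> < 1" using n1 by (simp add: mult_less_cancel_left)
    have "embed x k = embed y k" using xy by simp
    then have "cis \<theta> = 1" by (simp add: embed_def \<theta>_def inner_diff_left cis_divide[symmetric])
    then have "cos \<theta> = 1" by (simp add: complex_eq_iff)
    then have "\<theta> = 0"
    proof -
      have "cos \<bar>\<theta>\<bar> = cos 0" using \<open>cos \<theta> = 1\<close> by simp
      then have "\<bar>\<theta>\<bar> = 0"
        using cos_inj_pi[of "\<bar>\<theta>\<bar>" 0] small pi_gt3 by linarith
      then show ?thesis by simp
    qed
    then show ?thesis using k by (simp add: \<theta>_def)
  qed
  then have "x - y = 0" by (rule separating)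
  then show "x = y" by simp
qed

lemma embed_compact_closed: "compact K \<Longrightarrow> closed (embed ` K)"
  by (intro compact_imp_closed compact_continuous_image continuous_embed)

lemma embed_law:
  assumes "borel_prob M"
  shows "borel_prob (distr M borel embed)" "AE \<omega> in distr M borel embed. \<omega> \<in> characters d"
    "(\<integral>\<omega>. \<omega> i \<partial>distr M borel embed) = hchar M (d i)"
proof -
  have m: "embed \<in> measurable M borel" using assms measurable_embed by (simp cong: measurable_cong_sets)
  show "borel_prob (distr M borel embed)" using borel_prob_distr[OF assms measurable_embed] .
  show "AE \<omega> in distr M borel embed. \<omega> \<in> characters d"
    by (subst AE_distr_iff[OF m measurable_characters]) (auto simp: embed_in_characters)
  show "(\<integral>\<omega>. \<omega> i \<partial>distr M borel embed) = hchar M (d i)"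
    by (subst integral_distr[OF m]) (auto simp: embed_def hchar_def)
qed

text \<open>
  The images of \<open>M\<close> and \<open>N\<close> under the continuous injection \<open>embed\<close> coincide, so \<open>M\<close> and \<open>N\<close> agree on compact sets,
  whose images are closed; inner regularity extends this to Borel sets.
\<close>
lemma hchar_unique:
  assumes M: "borel_prob M" and N: "borel_prob N" and eq: "\<And>i. hchar M (d i) = hchar N (d i)"
  shows "M = N"
proof -
  interpret M: prob_space M using M by simp
  interpret N: prob_space N using N by simp
  have law: "distr M borel embed = distr N borel embed"
    using character_law_unique embed_law[OF M] embed_law[OF N] eq by auto
  have em: "embed \<in> measurable M borel" "embed \<in> measurable N borel"
    using M N measurable_embed by (simp_all cong: measurable_cong_sets)
  have compact: "emeasure M K = emeasure N K" if "compact K" for K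
  proof -
    have "embed -` (embed ` K) = K" by (rule inj_vimage_image_eq[OF inj_embed])
    moreover have "embed ` K \<in> sets borel" using embed_compact_closed[OF that] by auto
    ultimately show ?thesis
      using arg_cong[OF law, of "\<lambda>Q. emeasure Q (embed ` K)"] em M N
      by (simp add: emeasure_distr space_borel_prob)
  qed
  show ?thesis
  proof (rule measure_eqI)
    fix A assume "A \<in> sets M"
    then have A: "A \<in> sets borel" using M by simp
    have "emeasure M A = (SUP K\<in>{K. K \<subseteq> A \<and> compact K}. emeasure M K)"
      by (rule inner_regular) (use M A in auto)
    also have "\<dots> = (SUP K\<in>{K. K \<subseteq> A \<and> compact K}. emeasure N K)"
      by (rule SUP_cong) (auto simp: compact)
    also have "\<dots> = emeasure N A"
      by (rule inner_regular[symmetric]) (use N A in auto)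
    finally show "emeasure M A = emeasure N A" .
  qed (use M N in simp)
qed

end

context frequency_group
begin

definition point :: "(nat \<Rightarrow> complex) \<Rightarrow> 'a" where
  "point \<omega> = (if \<omega> \<in> range embed then inv embed \<omega> else 0)"

lemma point_embed [simp]: "point (embed x) = x"
  by (simp add: point_def inj_embed)

text \<open>
  The inverse of \<open>embed\<close> is not continuous, but it is Borel on the image of a \<open>\<sigma>\<close>-compact set, since it pulls
  closed sets back to countable unions of compact ones.
\<close>
lemma point_on_sigma_compact_measurable:
  assumes K: "\<And>m::nat. compact (K m)"
  defines "f \<equiv> (\<lambda>\<omega>. if \<omega> \<in> embed ` (\<Union>m. K m) then point \<omega> else 0)"
  shows "f \<in> measurable borel borel"
proof -
  let ?L = "embed ` (\<Union>m. K m)"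
  have L: "embed ` (\<Union>m. K m \<inter> F) \<in> sets borel" if "closed F" for F
  proof -
    have "embed ` (\<Union>m. K m \<inter> F) = (\<Union>m. embed ` (K m \<inter> F))" by auto
    also have "\<dots> \<in> sets borel"
      using embed_compact_closed[OF compact_Int_closed[OF K that]] by (intro sets.countable_UN) auto
    finally show ?thesis .
  qed
  have L': "?L \<in> sets borel" using L[of UNIV] by simp
  show ?thesis
    unfolding borel_eq_closed[where 'a = 'a]
  proof (rule measurable_measure_of)
    fix F :: "'a set" assume "F \<in> Collect closed"
    then have F: "closed F" by simp
    have "f -` F = embed ` (\<Union>m. K m \<inter> F) \<union> (if 0 \<in> F then - ?L else {})"
    proof (rule set_eqI)
      fix \<omega>
      have on: "f (embed x) = x" if "x \<in> (\<Union>m. K m)" for x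
        using imageI[OF that, of embed] by (simp only: f_def if_True point_embed)
      have off: "f \<omega> = 0" if "\<omega> \<notin> ?L" using that by (simp only: f_def if_False)
      show "\<omega> \<in> f -` F \<longleftrightarrow> \<omega> \<in> embed ` (\<Union>m. K m \<inter> F) \<union> (if 0 \<in> F then - ?L else {})"
      proof (cases "\<omega> \<in> ?L")
        case True
        then obtain x where x: "\<omega> = embed x" "x \<in> (\<Union>m. K m)" by blast
        have "\<omega> \<in> f -` F \<longleftrightarrow> x \<in> F" using on[OF x(2)] x(1) by simp
        moreover have "\<omega> \<in> embed ` (\<Union>m. K m \<inter> F) \<longleftrightarrow> x \<in> F"
          using x inj_image_mem_iff[OF inj_embed] by auto
        ultimately show ?thesis using True by (simp del: image_UN)
      next
        case False
        then have "\<omega> \<notin> embed ` (\<Union>m. K m \<inter> F)" by blast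
        then show ?thesis using False off by (simp del: image_UN)
      qed
    qed
    also have "\<dots> \<in> sets borel" using L[OF F] L' by (auto simp del: image_UN)
    finally show "f -` F \<inter> space borel \<in> sets borel" by simp
  qed auto
qed

text \<open>
  By Ulam's theorem a \<open>\<sigma>\<close>-compact set carries \<open>M\<close>. Its image is a Borel set of characters on which the
  vector can be recovered measurably, and which can therefore stand in for the whole image of \<open>embed\<close>.
\<close>
lemma embedded_support:
  assumes M: "borel_prob M"
  obtains L :: "(nat \<Rightarrow> complex) set" and f where
    "L \<in> sets borel" "L \<subseteq> range embed" "f \<in> measurable borel borel" "\<And>\<omega>. \<omega> \<in> L \<Longrightarrow> embed (f \<omega>) = \<omega>"
    "AE \<omega> in distr M borel embed. \<omega> \<in> L"
proof -
  obtain K where K: "\<And>m::nat. compact (K m)" and ae: "AE x in M. x \<in> (\<Union>m. K m)"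
    using sigma_compact_support[OF M] by blast
  let ?L = "embed ` (\<Union>m. K m)"
  have L: "?L \<in> sets borel"
    unfolding image_UN using embed_compact_closed[OF K] by (intro sets.countable_UN) auto
  have m: "embed \<in> measurable M borel" using M measurable_embed by (simp cong: measurable_cong_sets)
  show ?thesis
  proof
    show "?L \<in> sets borel" "?L \<subseteq> range embed" using L by auto
    show "(\<lambda>\<omega>. if \<omega> \<in> ?L then point \<omega> else 0) \<in> measurable borel borel"
      by (rule point_on_sigma_compact_measurable[OF K])
    show "embed (if \<omega> \<in> ?L then point \<omega> else 0) = \<omega>" if "\<omega> \<in> ?L" for \<omega>
      using that by auto
    show "AE \<omega> in distr M borel embed. \<omega> \<in> ?L"
      using ae L by (subst AE_distr_iff[OF m]) auto
  qed
qed

text \<open>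
  If a translate of the law of \<open>embed\<close> under \<open>M\<close> by a character \<open>b\<close> is again carried by the image of \<open>embed\<close>, then
  this image, a subgroup, meets its coset by \<open>b\<close>, and hence contains \<open>b\<close>.
\<close>
lemma translated_character_is_embedded:
  assumes M: "borel_prob M" and N: "borel_prob N" and b: "b \<in> characters d"
    and eq: "\<And>i. hchar N (d i) = b i * hchar M (d i)"
  obtains y where "b = embed y"
proof -
  have mM: "embed \<in> measurable M borel" using M measurable_embed by (simp cong: measurable_cong_sets)
  have mul: "(\<lambda>\<omega> i. b i * \<omega> i) \<in> measurable (borel :: (nat \<Rightarrow> complex) measure) borel"
    by (rule measurable_coordinatewise_then_product) measurable
  have bm: "(\<lambda>x i. b i * embed x i) \<in> measurable borel borel"
    using measurable_compose[OF measurable_embed mul] .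
  then have bM: "(\<lambda>x i. b i * embed x i) \<in> measurable M borel" using M by (simp cong: measurable_cong_sets)
  have be: "(\<lambda>i. b i * embed x i) \<in> characters d" for x
    using b embed_in_characters[of x] by (auto simp: characters_def norm_mult)
  define R where "R = distr M borel (\<lambda>x i. b i * embed x i)"
  have "R = distr N borel embed"
  proof (rule character_law_unique)
    show "prob_space R" "sets R = sets borel" using borel_prob_distr[OF M bm] by (auto simp: R_def)
    show "AE \<omega> in R. \<omega> \<in> characters d"
      unfolding R_def by (subst AE_distr_iff[OF bM measurable_characters]) (auto simp: be)
    fix i
    have "(\<integral>\<omega>. \<omega> i \<partial>R) = (\<integral>x. b i * embed x i \<partial>M)"
      unfolding R_def by (rule integral_distr[OF bM]) measurable
    then show "(\<integral>\<omega>. \<omega> i \<partial>R) = (\<integral>\<omega>. \<omega> i \<partial>distr N borel embed)"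
      using embed_law(3)[OF N] eq by (simp add: hchar_def embed_def)
  qed (use embed_law[OF N] in auto)
  moreover obtain L where L: "L \<in> sets borel" "L \<subseteq> range embed" "AE \<omega> in distr N borel embed. \<omega> \<in> L"
    using embedded_support[OF N] by metis
  ultimately have "AE \<omega> in distr M borel (\<lambda>x i. b i * embed x i). \<omega> \<in> L" unfolding R_def by metis
  from AE_distrD[OF bM this] have "AE x in M. (\<lambda>i. b i * embed x i) \<in> L" .
  moreover have "\<not> (AE x in M. False)" using M by (simp add: prob_space.AE_False)
  ultimately obtain x where "(\<lambda>i. b i * embed x i) \<in> L"
    by (metis (mono_tags, lifting) eventually_mono)
  then obtain z where z: "(\<lambda>i. b i * embed x i) = embed z" using L(2) by auto
  have "b i = embed (z - x) i" for i
  proof -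
    have "embed z i = embed (z - x) i * embed x i" using embed_add[of "z - x" x] by simp
    moreover have "embed z i = b i * embed x i" using fun_cong[OF z, of i] by simp
    moreover have "embed x i \<noteq> 0" by (simp add: embed_def)
    ultimately show ?thesis by simp
  qed
  then show ?thesis using that by blast
qed

section \<open>Convolution roots as limits\<close>

lemma hchar_limit_law:
  assumes \<tau>: "\<And>j::nat. borel_prob (\<tau> j)"
  obtains s Q where "strict_mono (s :: nat \<Rightarrow> nat)" "borel_prob Q" "AE \<omega> in Q. \<omega> \<in> characters d"
    "\<And>i. (\<lambda>j. hchar (\<tau> (s j)) (d i)) \<longlonglongrightarrow> (\<integral>\<omega>. \<omega> i \<partial>Q)"
proof -
  obtain s Q where *: "strict_mono (s :: nat \<Rightarrow> nat)" "prob_space Q" "sets Q = sets borel" "AE \<omega> in Q. \<omega> \<in> characters d"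
    "\<And>i. (\<lambda>j. \<integral>\<omega>. \<omega> i \<partial>distr (\<tau> (s j)) borel embed) \<longlonglongrightarrow> (\<integral>\<omega>. \<omega> i \<partial>Q)"
    using character_laws_compact[of "\<lambda>j. distr (\<tau> j) borel embed" d] embed_law(1,2)[OF \<tau>] by metis
  show ?thesis
    by (rule that[of s Q]) (use * embed_law(3)[OF \<tau>] in auto)
qed

text \<open>
  Limits of the laws \<open>\<tau> j\<close> exist as laws of characters, with the right coefficients, but they may live
  outside the Hilbert space. That they do not, up to a translation, follows from the convolution identity:
  the product of two independent random characters with laws \<open>Q\<close> and \<open>Q'\<close> has the law of \<open>embed\<close> under \<open>M\<close>,
  so it almost surely comes from the Hilbert space. Freezing the value \<open>c\<close> of one factor shows
  that \<open>Q\<close> is carried by one coset of the Hilbert space.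
\<close>
lemma conv_root_of_hchar_limit:
  assumes M: "borel_prob M" and n: "n \<ge> 1" and \<tau>: "\<And>j::nat. borel_prob (\<tau> j)"
    and lim: "\<And>i. (\<lambda>j. hchar (\<tau> j) (d i) ^ n) \<longlonglongrightarrow> hchar M (d i)"
  obtains N where "borel_prob N" "M = measure_conv_power n N"
proof -
  \<comment> \<open>\<open>Q\<close> is a limit of the \<open>\<tau> j\<close>, and \<open>Q'\<close> of their \<open>(n - 1)\<close>-fold convolution powers.\<close>
  obtain s Q where s: "strict_mono (s :: nat \<Rightarrow> nat)" and Q: "borel_prob Q"
    and Qc: "AE \<omega> in Q. \<omega> \<in> characters d"
    and Ql: "\<And>i. (\<lambda>j. hchar (\<tau> (s j)) (d i)) \<longlonglongrightarrow> (\<integral>\<omega>. \<omega> i \<partial>Q)"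
    using hchar_limit_law[of \<tau>] \<tau> by blast
  define \<sigma> where "\<sigma> j = measure_conv_power (n - 1) (\<tau> (s j))" for j
  have \<sigma>: "borel_prob (\<sigma> j)" for j unfolding \<sigma>_def by (rule borel_prob_conv_power[OF \<tau>])
  obtain r Q' where r: "strict_mono (r :: nat \<Rightarrow> nat)" and Q': "borel_prob Q'"
    and Q'c: "AE \<omega> in Q'. \<omega> \<in> characters d"
    and Q'l: "\<And>i. (\<lambda>j. hchar (\<sigma> (r j)) (d i)) \<longlonglongrightarrow> (\<integral>\<omega>. \<omega> i \<partial>Q')"
    using hchar_limit_law[of \<sigma>] \<sigma> by blast
  define \<rho> where "\<rho> i = (\<integral>\<omega>. \<omega> i \<partial>Q)" for i
  have "(\<lambda>j. hchar (\<tau> (s j)) (d i) ^ n) \<longlonglongrightarrow> \<rho> i ^ n" for i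
    unfolding \<rho>_def by (intro tendsto_power Ql)
  then have \<rho>: "\<rho> i ^ n = hchar M (d i)" for i
    using LIMSEQ_unique LIMSEQ_subseq_LIMSEQ[OF lim s, of i] by (auto simp: o_def)
  have \<rho>': "(\<integral>\<omega>. \<omega> i \<partial>Q') = \<rho> i ^ (n - 1)" for i
  proof (rule LIMSEQ_unique[OF Q'l])
    have "(\<lambda>j. hchar (\<sigma> j) (d i)) \<longlonglongrightarrow> \<rho> i ^ (n - 1)"
      unfolding \<sigma>_def hchar_conv_power[OF \<tau>] \<rho>_def by (intro tendsto_power Ql)
    from LIMSEQ_subseq_LIMSEQ[OF this r] show "(\<lambda>j. hchar (\<sigma> (r j)) (d i)) \<longlonglongrightarrow> \<rho> i ^ (n - 1)"
      by (simp add: o_def)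
  qed
  \<comment> \<open>Fubini provides the character \<open>c\<close> for which \<open>c * \<omega>\<close> comes from the Hilbert space for
    \<open>Q\<close>-almost every \<open>\<omega>\<close>.\<close>
  interpret Q: prob_space Q using Q by simp
  interpret Q': prob_space Q' using Q' by simp
  interpret P: pair_prob_space Q' Q ..
  have [measurable_cong]: "sets Q = sets borel" "sets Q' = sets borel" using Q Q' by auto
  have prod: "(\<lambda>z i. fst z i * snd z i) \<in> measurable (Q' \<Otimes>\<^sub>M Q) borel"
    by (rule measurable_coordinatewise_then_product) measurable
  define R where "R = distr (Q' \<Otimes>\<^sub>M Q) borel (\<lambda>z i. fst z i * snd z i)"
  have "R = distr M borel embed"
  proof (rule character_law_unique)
    show "prob_space R" "sets R = sets borel" using P.prob_space_distr[OF prod] by (auto simp: R_def)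
    have [measurable]: "Measurable.pred borel (\<lambda>\<omega>. \<omega> \<in> characters d)"
      using measurable_characters[of d] by (simp add: pred_def)
    have "AE z in Q' \<Otimes>\<^sub>M Q. fst z \<in> characters d"
      by (rule P.AE_pair_measure) (use Q'c in \<open>measurable, auto\<close>)
    moreover have "AE z in Q' \<Otimes>\<^sub>M Q. snd z \<in> characters d"
      by (rule P.AE_pair_measure) (use Qc in \<open>measurable, auto\<close>)
    ultimately have "AE z in Q' \<Otimes>\<^sub>M Q. (\<lambda>i. fst z i * snd z i) \<in> characters d"
      by eventually_elim (auto simp: characters_def norm_mult)
    then show "AE \<omega> in R. \<omega> \<in> characters d"
      unfolding R_def by (subst AE_distr_iff[OF prod measurable_characters])
    fix i
    have "integrable Q' (\<lambda>\<omega>. \<omega> i)"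
      by (rule Q'.integrable_const_bound[of _ 1]) (use Q'c in \<open>auto simp: norm_character elim!: eventually_mono\<close>)
    moreover have "integrable Q (\<lambda>\<omega>. \<omega> i)"
      by (rule Q.integrable_const_bound[of _ 1]) (use Qc in \<open>auto simp: norm_character elim!: eventually_mono\<close>)
    ultimately have *: "(\<integral>z. fst z i * snd z i \<partial>(Q' \<Otimes>\<^sub>M Q)) = (\<integral>\<omega>. \<omega> i \<partial>Q') * (\<integral>\<omega>. \<omega> i \<partial>Q)"
      by (intro integral_pair_mult prob_space_imp_sigma_finite Q'.prob_space_axioms Q.prob_space_axioms)
    have "(\<integral>\<omega>. \<omega> i \<partial>R) = (\<integral>z. fst z i * snd z i \<partial>(Q' \<Otimes>\<^sub>M Q))"
      unfolding R_def by (rule integral_distr[OF prod]) measurable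
    also have "\<dots> = (\<integral>\<omega>. \<omega> i \<partial>Q') * (\<integral>\<omega>. \<omega> i \<partial>Q)" by (rule *)
    also have "\<dots> = \<rho> i ^ n" using n by (simp add: \<rho>' flip: \<rho>_def power_Suc2)
    finally show "(\<integral>\<omega>. \<omega> i \<partial>R) = (\<integral>\<omega>. \<omega> i \<partial>distr M borel embed)"
      using embed_law(3)[OF M] \<rho> by simp
  qed (use embed_law[OF M] in auto)
  moreover obtain L f where L: "L \<in> sets borel" and f: "f \<in> measurable borel borel"
    and fL: "\<And>\<omega>. \<omega> \<in> L \<Longrightarrow> embed (f \<omega>) = \<omega>" and LM: "AE \<omega> in distr M borel embed. \<omega> \<in> L"
    using embedded_support[OF M] by metis
  ultimately have "AE \<omega> in distr (Q' \<Otimes>\<^sub>M Q) borel (\<lambda>z i. fst z i * snd z i). \<omega> \<in> L" unfolding R_def by metis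
  from P.AE_pair[OF AE_distrD[OF prod this]] have "AE c in Q'. AE \<omega> in Q. (\<lambda>i. c i * \<omega> i) \<in> L" by simp
  with Q'c have ae: "AE c in Q'. c \<in> characters d \<and> (AE \<omega> in Q. (\<lambda>i. c i * \<omega> i) \<in> L)"
    by (rule AE_conjI)
  have "\<exists>c. c \<in> characters d \<and> (AE \<omega> in Q. (\<lambda>i. c i * \<omega> i) \<in> L)"
  proof (rule ccontr)
    assume "\<not> ?thesis"
    then have "AE c in Q'. False" using eventually_mono[OF ae, of "\<lambda>_. False"] by blast
    then show False by (simp add: Q'.AE_False)
  qed
  then obtain c where c: "c \<in> characters d" and cL: "AE \<omega> in Q. (\<lambda>i. c i * \<omega> i) \<in> L" by blast
  \<comment> \<open>\<open>N\<close> is a root of \<open>M\<close> up to the translation by \<open>c\<close>; the next steps show that \<open>c\<close> itself comes from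
    a vector, which can then be subtracted.\<close>
  have mul: "(\<lambda>\<omega> i. c i * \<omega> i) \<in> measurable (borel :: (nat \<Rightarrow> complex) measure) borel"
    by (rule measurable_coordinatewise_then_product) measurable
  define g where "g \<omega> = f (\<lambda>i. c i * \<omega> i)" for \<omega>
  have g: "g \<in> measurable borel borel" unfolding g_def using measurable_compose[OF mul f] .
  define N where "N = distr Q borel g"
  have N: "borel_prob N" unfolding N_def by (rule borel_prob_distr[OF Q g])
  have Nc: "hchar N (d i) = c i * \<rho> i" for i
  proof -
    have "hchar N (d i) = (\<integral>\<omega>. cis (g \<omega> \<bullet> d i) \<partial>Q)"
      unfolding N_def by (rule hchar_distr) (use Q g in auto)
    also have "\<dots> = (\<integral>\<omega>. c i * \<omega> i \<partial>Q)"
    proof (rule integral_cong_AE)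
      show "AE \<omega> in Q. cis (g \<omega> \<bullet> d i) = c i * \<omega> i"
        using cL
      proof eventually_elim
        case (elim \<omega>)
        have "cis (g \<omega> \<bullet> d i) = embed (f (\<lambda>i. c i * \<omega> i)) i" by (simp add: g_def embed_def)
        then show ?case using fL[OF elim] by simp
      qed
      have "(\<lambda>\<omega>. cis (g \<omega> \<bullet> d i)) \<in> borel_measurable borel"
        using measurable_compose[OF g measurable_cis_inner] .
      then show "(\<lambda>\<omega>. cis (g \<omega> \<bullet> d i)) \<in> borel_measurable Q" by measurable
    qed measurable
    finally show ?thesis by (simp add: \<rho>_def)
  qed
  have cn: "(\<lambda>i. c i ^ n) \<in> characters d"
    using c by (auto simp: characters_def norm_power power_mult_distrib)
  obtain y where y: "(\<lambda>i. c i ^ n) = embed y"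
  proof (rule translated_character_is_embedded[OF M borel_prob_conv_power[OF N, of n] cn])
    show "hchar (measure_conv_power n N) (d i) = c i ^ n * hchar M (d i)" for i
      by (simp add: hchar_conv_power[OF N] Nc power_mult_distrib \<rho>)
  qed
  \<comment> \<open>A character of a divisible group is the \<open>n\<close>-th power of its values at \<open>n\<close>-th parts of the
    frequencies, so \<open>c\<close> inherits its form from \<open>c ^ n\<close>.\<close>
  have c_eq: "c i = cis ((y /\<^sub>R real n) \<bullet> d i)" for i
  proof -
    obtain k where k: "d i = real n *\<^sub>R d k" using divisible[OF n] by blast
    have pow: "c j = c k ^ m" if "d j = real m *\<^sub>R d k" for j m
      using that
    proof (induction m arbitrary: j)
      case 0 then show ?case using character_zero[OF c, of j] by simp
    next
      case (Suc m)
      have "\<exists>l. d l = real m *\<^sub>R d k"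
      proof (induction m)
        case 0 then show ?case using range_zero by (metis imageE of_nat_0 scaleR_zero_left)
      next
        case (Suc m)
        then obtain l where "d l = real m *\<^sub>R d k" by blast
        then show ?case using range_add[of k l] by (auto simp: algebra_simps)
      qed
      then obtain l where l: "d l = real m *\<^sub>R d k" by blast
      then have "d j = d k + d l" using Suc.prems by (simp add: algebra_simps)
      then show ?case using character_add[OF c] Suc.IH[OF l] by simp
    qed
    have "c i = c k ^ n" by (rule pow[OF k])
    also have "\<dots> = cis (y \<bullet> d k)" using fun_cong[OF y, of k] by (simp add: embed_def)
    finally show ?thesis using k n by (simp add: mult.assoc[symmetric])
  qed
  define N' where "N' = distr N borel (\<lambda>x. x + - (y /\<^sub>R real n))"
  have "(\<lambda>x::'a. x + - (y /\<^sub>R real n)) \<in> measurable borel borel"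
    by (intro borel_measurable_continuous_onI continuous_intros)
  then have N': "borel_prob N'" unfolding N'_def by (rule borel_prob_distr[OF N])
  have "hchar N' (d i) = \<rho> i" for i
  proof -
    have "hchar N' (d i) = cis (- (y /\<^sub>R real n) \<bullet> d i) * (cis ((y /\<^sub>R real n) \<bullet> d i) * \<rho> i)"
      unfolding N'_def hchar_translate[OF N] Nc c_eq ..
    then show ?thesis by (simp add: mult.assoc[symmetric] cis_mult)
  qed
  then have "hchar M (d i) = hchar (measure_conv_power n N') (d i)" for i
    by (simp add: hchar_conv_power[OF N'] \<rho>)
  from hchar_unique[OF M borel_prob_conv_power[OF N'] this] show ?thesis using that N' by blast
qed

end

section \<open>Approximate convolution roots\<close>

text \<open>
  For \<open>h\<close> in the group generated by \<open>F\<close>, the function \<open>cis (y \<bullet> h) - 1\<close> is a combination of sines \<open>sin (y \<bullet> f)\<close> up to an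
  error controlled by \<open>1 - cos (y \<bullet> f)\<close>, uniformly in \<open>y\<close>. The restriction to this group matters: for other \<open>h\<close> the
  right-hand side may vanish at points \<open>y\<close> where the left-hand side does not.
\<close>
definition first_order :: "'a::real_inner set \<Rightarrow> 'a \<Rightarrow> bool" where
  "first_order F h \<longleftrightarrow> (\<exists>\<beta> C. 0 \<le> C \<and> (\<forall>y. norm (cis (y \<bullet> h) - 1 - \<i> * of_real (\<Sum>f\<in>F. \<beta> f * sin (y \<bullet> f)))
      \<le> C * (\<Sum>f\<in>F. 1 - cos (y \<bullet> f))))"

lemma first_order_mem:
  assumes "finite F" "f \<in> F" shows "first_order F f"
  unfolding first_order_def
proof (intro exI conjI allI)
  fix y
  have "(\<Sum>g\<in>F. (if g = f then 1 else 0) * sin (y \<bullet> g)) = sin (y \<bullet> f)"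
    using assms by (subst sum.remove[of _ f]) (auto intro: sum.neutral)
  then have "cis (y \<bullet> f) - 1 - \<i> * of_real (\<Sum>g\<in>F. (if g = f then 1 else 0) * sin (y \<bullet> g)) = of_real (cos (y \<bullet> f) - 1)"
    by (simp add: complex_eq_iff)
  then have "norm (cis (y \<bullet> f) - 1 - \<i> * of_real (\<Sum>g\<in>F. (if g = f then 1 else 0) * sin (y \<bullet> g))) = 1 - cos (y \<bullet> f)"
    by (simp del: of_real_diff)
  also have "\<dots> \<le> (\<Sum>g\<in>F. 1 - cos (y \<bullet> g))"
    using assms by (intro member_le_sum[of f F "\<lambda>g. 1 - cos (y \<bullet> g)"]) auto
  finally show "norm (cis (y \<bullet> f) - 1 - \<i> * of_real (\<Sum>g\<in>F. (if g = f then 1 else 0) * sin (y \<bullet> g)))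
      \<le> 1 * (\<Sum>g\<in>F. 1 - cos (y \<bullet> g))" by simp
qed simp

lemma first_order_zero: "first_order F 0"
  unfolding first_order_def by (intro exI[of _ "\<lambda>_. 0"] exI[of _ 0]) simp

lemma first_order_uminus:
  assumes "first_order F h" shows "first_order F (- h)"
proof -
  obtain \<beta> C where C: "0 \<le> C" and b: "\<And>y. norm (cis (y \<bullet> h) - 1 - \<i> * of_real (\<Sum>f\<in>F. \<beta> f * sin (y \<bullet> f)))
      \<le> C * (\<Sum>f\<in>F. 1 - cos (y \<bullet> f))" using assms unfolding first_order_def by blast
  show ?thesis unfolding first_order_def
  proof (intro exI conjI allI)
    fix y
    have "cis (y \<bullet> - h) - 1 - \<i> * of_real (\<Sum>f\<in>F. - \<beta> f * sin (y \<bullet> f))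
        = cnj (cis (y \<bullet> h) - 1 - \<i> * of_real (\<Sum>f\<in>F. \<beta> f * sin (y \<bullet> f)))"
      by (simp add: cis_cnj sum_negf)
    then show "norm (cis (y \<bullet> - h) - 1 - \<i> * of_real (\<Sum>f\<in>F. - \<beta> f * sin (y \<bullet> f))) \<le> C * (\<Sum>f\<in>F. 1 - cos (y \<bullet> f))"
      using b[of y] by (simp only: complex_mod_cnj)
  qed (rule C)
qed

text \<open>
  In \<open>(u + 1) * (v + 1) - 1 = u + v + u * v\<close> the product is at most \<open>(\<bar>u\<bar>\<^sup>2 + \<bar>v\<bar>\<^sup>2) / 2\<close>, and for \<open>u = cis \<theta> - 1\<close>
  one has \<open>\<bar>u\<bar>\<^sup>2 = 2 * (1 - cos \<theta>)\<close>, twice the negative real part of \<open>u\<close>. The sine terms are purely imaginary, so the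
  hypotheses themselves bound this quantity.
\<close>
lemma first_order_add:
  assumes "first_order F h" "first_order F h'" shows "first_order F (h + h')"
proof -
  obtain \<beta> C where C: "0 \<le> C" and b: "\<And>y. norm (cis (y \<bullet> h) - 1 - \<i> * of_real (\<Sum>f\<in>F. \<beta> f * sin (y \<bullet> f)))
      \<le> C * (\<Sum>f\<in>F. 1 - cos (y \<bullet> f))" using assms(1) unfolding first_order_def by blast
  obtain \<beta>' C' where C': "0 \<le> C'" and b': "\<And>y. norm (cis (y \<bullet> h') - 1 - \<i> * of_real (\<Sum>f\<in>F. \<beta>' f * sin (y \<bullet> f)))
      \<le> C' * (\<Sum>f\<in>F. 1 - cos (y \<bullet> f))" using assms(2) unfolding first_order_def by blast
  have cos: "1 - cos (y \<bullet> k) \<le> D * (\<Sum>f\<in>F. 1 - cos (y \<bullet> f))"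
    if "norm (cis (y \<bullet> k) - 1 - \<i> * of_real r) \<le> D * (\<Sum>f\<in>F. 1 - cos (y \<bullet> f))" for y k r D
  proof -
    have "1 - cos (y \<bullet> k) = - Re (cis (y \<bullet> k) - 1 - \<i> * of_real r)" by simp
    also have "\<dots> \<le> norm (cis (y \<bullet> k) - 1 - \<i> * of_real r)" using abs_Re_le_cmod abs_le_D2 by blast
    finally show ?thesis using that by simp
  qed
  have sq: "(norm (cis a - 1))\<^sup>2 = 2 * (1 - cos a)" for a
  proof -
    have "(norm (cis a - 1))\<^sup>2 = (cos a)\<^sup>2 - 2 * cos a + 1 + (sin a)\<^sup>2"
      by (simp add: cmod_power2 power2_diff)
    then show ?thesis using sin_cos_squared_add[of a] by simp
  qed
  show ?thesis unfolding first_order_def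
  proof (intro exI conjI allI)
    fix y
    define S where "S = (\<Sum>f\<in>F. 1 - cos (y \<bullet> f))"
    define p where "p = (\<Sum>f\<in>F. \<beta> f * sin (y \<bullet> f))"
    define q where "q = (\<Sum>f\<in>F. \<beta>' f * sin (y \<bullet> f))"
    define u where "u = cis (y \<bullet> h) - 1"
    define v where "v = cis (y \<bullet> h') - 1"
    have "norm u * norm v \<le> ((norm u)\<^sup>2 + (norm v)\<^sup>2) / 2"
      using sum_squares_bound[of "norm u" "norm v"] by simp
    also have "\<dots> = (1 - cos (y \<bullet> h)) + (1 - cos (y \<bullet> h'))" by (simp add: u_def v_def sq)
    also have "\<dots> \<le> C * S + C' * S"
      unfolding S_def by (intro add_mono cos[OF b] cos[OF b'])
    finally have uv: "norm (u * v) \<le> C * S + C' * S" by (simp add: norm_mult)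
    have "cis (y \<bullet> (h + h')) = (u + 1) * (v + 1)" by (simp add: u_def v_def cis_mult inner_add_right)
    moreover have "(\<Sum>f\<in>F. (\<beta> f + \<beta>' f) * sin (y \<bullet> f)) = p + q"
      by (simp add: p_def q_def distrib_right sum.distrib)
    ultimately have "cis (y \<bullet> (h + h')) - 1 - \<i> * of_real (\<Sum>f\<in>F. (\<beta> f + \<beta>' f) * sin (y \<bullet> f))
        = (u - \<i> * of_real p) + (v - \<i> * of_real q) + u * v"
      by (simp add: algebra_simps)
    also have "norm \<dots> \<le> C * S + C' * S + (C * S + C' * S)"
      using b[of y] b'[of y] uv by (intro norm_triangle_mono) (auto simp: u_def v_def p_def q_def S_def)
    finally show "norm (cis (y \<bullet> (h + h')) - 1 - \<i> * of_real (\<Sum>f\<in>F. (\<beta> f + \<beta>' f) * sin (y \<bullet> f)))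
        \<le> (2 * (C + C')) * (\<Sum>f\<in>F. 1 - cos (y \<bullet> f))"
      by (simp add: S_def algebra_simps)
  qed (use C C' in simp)
qed

lemma first_order_lattice:
  fixes j :: nat
  assumes "finite F" "\<And>l. l < j \<Longrightarrow> w l \<in> F"
  shows "first_order F (\<Sum>l<j. of_int (m l) *\<^sub>R w l)"
proof -
  have nat: "first_order F (real n *\<^sub>R f)" if "f \<in> F" for n :: nat and f
  proof (induction n)
    case 0 then show ?case by (simp add: first_order_zero)
  next
    case (Suc n)
    then show ?case using first_order_add[OF first_order_mem[OF assms(1) that] Suc]
      by (simp add: algebra_simps)
  qed
  have int: "first_order F (of_int k *\<^sub>R f)" if "f \<in> F" for k :: int and f
    using nat[OF that] first_order_uminus[OF nat[OF that]] by (cases k rule: int_cases2) auto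
  show ?thesis using assms(2)
  proof (induction j)
    case 0 then show ?case by (simp add: first_order_zero)
  next
    case (Suc j) then show ?case by (auto intro!: first_order_add int)
  qed
qed

text \<open>
  The vector \<open>a\<close> prescribes the arguments of the characteristic function at the frequencies in \<open>F\<close>. Orthogonality
  makes these prescriptions independent; at the frequency 0 nothing has to be prescribed.
\<close>
lemma exists_centering:
  fixes M :: "'a::real_inner measure"
  assumes M: "borel_prob M" and F: "finite F" and orth: "pairwise (\<lambda>f g. f \<bullet> g = 0) F"
  obtains a where "\<And>f. f \<in> F \<Longrightarrow> hchar M f = of_real (norm (hchar M f)) * cis (a \<bullet> f)"
proof
  fix f assume f: "f \<in> F"
  let ?a = "\<Sum>g\<in>F. (Arg (hchar M g) / (g \<bullet> g)) *\<^sub>R g"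
  show "hchar M f = of_real (norm (hchar M f)) * cis (?a \<bullet> f)"
  proof (cases "f = 0")
    case True then show ?thesis using hchar_zero[OF M] by simp
  next
    case False
    have "?a \<bullet> f = (\<Sum>g\<in>F. Arg (hchar M g) / (g \<bullet> g) * (g \<bullet> f))" by (simp add: inner_sum_left)
    also have "\<dots> = Arg (hchar M f) / (f \<bullet> f) * (f \<bullet> f) + (\<Sum>g\<in>F - {f}. Arg (hchar M g) / (g \<bullet> g) * (g \<bullet> f))"
      by (rule sum.remove[OF F f])
    also have "(\<Sum>g\<in>F - {f}. Arg (hchar M g) / (g \<bullet> g) * (g \<bullet> f)) = 0"
      using orth f by (intro sum.neutral) (auto simp: pairwise_def)
    finally have "?a \<bullet> f = Arg (hchar M f)" using False by simp
    then show ?thesis using rcis_cmod_Arg[of "hchar M f"] by (simp add: rcis_def)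
  qed
qed

text \<open>
  The hypothesis \<open>real\<close> says that the sines have mean zero, so that only the error term remains, whose
  mean is expressed by the moduli \<open>norm (hchar M f)\<close>. A bound by \<open>1 - norm (hchar M f)\<close>, and not by its square root, is
  the purpose of the centering.
\<close>
lemma centered_hchar_bound:
  fixes M :: "'a::real_inner measure"
  assumes M: "borel_prob M" and F: "finite F"
    and real: "\<And>f. f \<in> F \<Longrightarrow> hchar M f = of_real (norm (hchar M f))"
    and b: "\<And>y. norm (cis (y \<bullet> h) - 1 - \<i> * of_real (\<Sum>f\<in>F. \<beta> f * sin (y \<bullet> f))) \<le> C * (\<Sum>f\<in>F. 1 - cos (y \<bullet> f))"
  shows "norm (hchar M h - 1) \<le> C * (\<Sum>f\<in>F. 1 - norm (hchar M f))"
proof -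
  interpret prob_space M using M by simp
  have ci: "integrable M (\<lambda>x. cis (x \<bullet> f))" for f by (rule integrable_cis[OF M measurable_inner_borel])
  have re: "integrable M (\<lambda>x. cos (x \<bullet> f))" "(\<integral>x. cos (x \<bullet> f) \<partial>M) = Re (hchar M f)"
    and im: "integrable M (\<lambda>x. sin (x \<bullet> f))" "(\<integral>x. sin (x \<bullet> f) \<partial>M) = Im (hchar M f)" for f
    using integrable_Re[OF ci[of f]] integrable_Im[OF ci[of f]] integral_Re[OF ci[of f]] integral_Im[OF ci[of f]]
    by (simp_all add: hchar_def)
  have sin0: "(\<integral>x. sin (x \<bullet> f) \<partial>M) = 0" if "f \<in> F" for f
    using real[OF that] im(2)[of f] by (metis Im_complex_of_real)
  have cosF: "(\<integral>x. cos (x \<bullet> f) \<partial>M) = norm (hchar M f)" if "f \<in> F" for f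
    using real[OF that] re(2)[of f] by (metis Re_complex_of_real)
  let ?p = "\<lambda>x. \<Sum>f\<in>F. \<beta> f * sin (x \<bullet> f)"
  have pi: "integrable M ?p" using im by auto
  have p0: "(\<integral>x. ?p x \<partial>M) = 0" using im sin0 by (subst Bochner_Integration.integral_sum) auto
  have "hchar M h - 1 = (\<integral>x. cis (x \<bullet> h) - 1 - \<i> * of_real (?p x) \<partial>M)"
  proof -
    have "(\<integral>x. \<i> * of_real (?p x) \<partial>M) = \<i> * of_real (\<integral>x. ?p x \<partial>M)"
      by (simp del: of_real_sum of_real_mult)
    moreover have "integrable M (\<lambda>x. \<i> * complex_of_real (?p x))"
      using pi by (intro integrable_mult_right integrable_of_real)
    ultimately show ?thesis
      using ci[of h] p0 by (simp add: hchar_def prob_space del: of_real_sum of_real_mult)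
  qed
  also have "norm \<dots> \<le> (\<integral>x. C * (\<Sum>f\<in>F. 1 - cos (x \<bullet> f)) \<partial>M)"
    by (rule order_trans[OF integral_norm_bound integral_mono])
       (use ci pi re b in \<open>auto intro!: integrable_norm Bochner_Integration.integrable_diff integrable_mult_right integrable_of_real integrable_sum simp del: of_real_sum of_real_mult\<close>)
  also have "\<dots> = C * (\<Sum>f\<in>F. 1 - norm (hchar M f))"
  proof -
    have "(\<integral>x. (\<Sum>f\<in>F. 1 - cos (x \<bullet> f)) \<partial>M) = (\<Sum>f\<in>F. 1 - norm (hchar M f))"
      using re(1) by (subst Bochner_Integration.integral_sum) (auto simp: prob_space cosF intro!: sum.cong)
    then show ?thesis by simp
  qed
  finally show ?thesis .
qed

text \<open>
  Keep a random vector with probability \<open>p\<close> and replace it by 0 otherwise. For a law near the point mass at 0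
  this is the substitute for a convolution power with exponent \<open>p\<close>: to first order both multiply
  \<open>hchar M h - 1\<close> by \<open>p\<close>.
\<close>
lemma exists_thinning:
  fixes M :: "'a::{real_inner, second_countable_topology} measure"
  assumes M: "borel_prob M" and p: "0 \<le> p" "p \<le> 1"
  obtains N where "borel_prob N" "\<And>h. hchar N h = 1 + of_real p * (hchar M h - 1)"
proof -
  interpret M: prob_space M using M by simp
  interpret B: prob_space "measure_pmf (bernoulli_pmf p)" by (rule measure_pmf.prob_space_axioms)
  interpret P: pair_prob_space "measure_pmf (bernoulli_pmf p)" M ..
  let ?f = "\<lambda>(b, x::'a). if b then x else 0"
  have [measurable_cong]: "sets M = sets borel" using M by simp
  have f [measurable]: "?f \<in> measurable (measure_pmf (bernoulli_pmf p) \<Otimes>\<^sub>M M) borel" by measurable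
  define N where "N = distr (measure_pmf (bernoulli_pmf p) \<Otimes>\<^sub>M M) borel ?f"
  have N: "borel_prob N" unfolding N_def using P.prob_space_distr[OF f] by simp
  moreover have "hchar N h = 1 + of_real p * (hchar M h - 1)" for h
  proof -
    have "hchar N h = (\<integral>z. cis (?f z \<bullet> h) \<partial>(measure_pmf (bernoulli_pmf p) \<Otimes>\<^sub>M M))"
      unfolding hchar_def N_def by (rule integral_distr[OF f]) measurable
    also have "\<dots> = (\<integral>b. \<integral>x. cis (?f (b, x) \<bullet> h) \<partial>M \<partial>measure_pmf (bernoulli_pmf p))"
      by (rule P.integral_fst'[symmetric], rule P.integrable_const_bound[of _ 1])
         (use measurable_compose[OF f measurable_cis_inner] in auto)
    also have "\<dots> = of_real p * hchar M h + of_real (1 - p)"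
      using p by (subst integral_measure_pmf[of UNIV]) (auto simp: UNIV_bool hchar_def M.prob_space scaleR_conv_of_real)
    finally show ?thesis by (simp add: algebra_simps)
  qed
  ultimately show ?thesis using that by blast
qed

lemma power_one_plus_bound:
  "\<exists>K\<ge>0. \<forall>w::complex. norm w \<le> 1 \<longrightarrow> norm ((1 + w) ^ n - (1 + of_nat n * w)) \<le> K * (norm w)\<^sup>2"
proof (induction n)
  case 0 then show ?case by (intro exI[of _ 0]) simp
next
  case (Suc n)
  then obtain K where K: "K \<ge> 0" and b: "\<And>w::complex. norm w \<le> 1 \<Longrightarrow> norm ((1 + w) ^ n - (1 + of_nat n * w)) \<le> K * (norm w)\<^sup>2" by blast
  show ?case
  proof (intro exI conjI allI impI)
    fix w :: complex assume w: "norm w \<le> 1"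
    have "(1 + w) ^ Suc n - (1 + of_nat (Suc n) * w) = (1 + w) * ((1 + w) ^ n - (1 + of_nat n * w)) + of_nat n * w\<^sup>2"
      by (simp add: algebra_simps power2_eq_square)
    also have "norm \<dots> \<le> 2 * (K * (norm w)\<^sup>2) + real n * (norm w)\<^sup>2"
    proof (rule norm_triangle_mono)
      have "norm (1 + w) \<le> 2" using norm_triangle_ineq[of 1 w] w by simp
      then show "norm ((1 + w) * ((1 + w) ^ n - (1 + of_nat n * w))) \<le> 2 * (K * (norm w)\<^sup>2)"
        unfolding norm_mult by (intro mult_mono b w) auto
    qed (simp add: norm_mult norm_power)
    finally show "norm ((1 + w) ^ Suc n - (1 + of_nat (Suc n) * w)) \<le> (2 * K + real n) * (norm w)\<^sup>2"
      by (simp add: algebra_simps)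
  qed (use K in simp)
qed

lemma exists_conv_prod:
  fixes M :: "nat \<Rightarrow> 'a::{real_inner, second_countable_topology} measure"
  assumes "\<And>k. k < N \<Longrightarrow> borel_prob (M k)"
  shows "\<exists>R. borel_prob R \<and> (\<forall>h. hchar R h = (\<Prod>k<N. hchar (M k) h))"
  using assms
proof (induction N)
  case 0
  then show ?case using borel_prob_return[of "0::'a"]
    by (intro exI[of _ "return borel 0"]) (auto simp: hchar_def integral_return)
next
  case (Suc N)
  then obtain R where R: "borel_prob R" "\<And>h. hchar R h = (\<Prod>k<N. hchar (M k) h)" by auto
  have "borel_prob (M N)" using Suc.prems by simp
  then show ?case using borel_prob_measure_conv[OF R(1)] hchar_measure_conv[OF R(1)] R(2)
    by (intro exI[of _ "measure_conv R (M N)"]) auto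
qed

text \<open>
  The factorization is only required for characteristic functions. This avoids convolutions of finite families of measures.
\<close>
definition null_array :: "'a::real_inner measure \<Rightarrow> 'a set \<Rightarrow> bool" where
  "null_array M F \<longleftrightarrow> (\<forall>\<delta>>0. \<exists>N \<nu>. (\<forall>k<N. borel_prob (\<nu> k) \<and> (\<forall>f\<in>F. norm (hchar (\<nu> k) f - 1) \<le> \<delta>)) \<and>
     (\<forall>h. hchar M h = (\<Prod>k<(N::nat). hchar (\<nu> k) h)))"

text \<open>
  Each factor of a null array is centered, thinned with probability \<open>1 / n\<close>, and shifted by an \<open>n\<close>-th part of
  the centering vector. The \<open>n\<close>-th power of the resulting characteristic function differs from that of the factor by
  a quadratic error in the deviation \<open>e k\<close>. The deviations are small uniformly in \<open>k\<close> and, by the choice of the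
  centering, have a sum that is bounded independently of the array, so the sum of their squares is small.
\<close>
lemma approximate_root:
  fixes M :: "'a::{real_inner, second_countable_topology} measure"
  assumes null: "null_array M F" and F: "finite F" and orth: "pairwise (\<lambda>f g. f \<bullet> g = 0) F"
    and n: "n \<ge> 1" and T: "finite T" "\<And>h. h \<in> T \<Longrightarrow> first_order F h" and \<epsilon>: "\<epsilon> > 0"
  obtains \<tau> where "borel_prob \<tau>" "\<And>h. h \<in> T \<Longrightarrow> norm (hchar \<tau> h ^ n - hchar M h) \<le> \<epsilon>"
proof -
  define Q where "Q h \<beta> C \<longleftrightarrow> 0 \<le> C \<and> (\<forall>y. norm (cis (y \<bullet> h) - 1 - \<i> * of_real (\<Sum>f\<in>F. \<beta> f * sin (y \<bullet> f)))
      \<le> C * (\<Sum>f\<in>F. 1 - cos (y \<bullet> f)))" for h :: 'a and \<beta> :: "'a \<Rightarrow> real" and C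
  have "\<forall>h\<in>T. \<exists>p. Q h (fst p) (snd p)" using T(2) unfolding first_order_def Q_def by fastforce
  from bchoice[OF this] obtain p where p: "\<And>h. h \<in> T \<Longrightarrow> Q h (fst (p h)) (snd (p h))" by blast
  define \<beta> where "\<beta> h = fst (p h)" for h
  define C where "C h = snd (p h)" for h
  have C0: "\<And>h. h \<in> T \<Longrightarrow> 0 \<le> C h" and
    b: "\<And>h y. h \<in> T \<Longrightarrow> norm (cis (y \<bullet> h) - 1 - \<i> * of_real (\<Sum>f\<in>F. \<beta> h f * sin (y \<bullet> f))) \<le> C h * (\<Sum>f\<in>F. 1 - cos (y \<bullet> f))"
    using p unfolding Q_def \<beta>_def C_def by blast+
  define D where "D = 1 + (\<Sum>h\<in>T. C h)"
  have D1: "D \<ge> 1" unfolding D_def using sum_nonneg[of T C] C0 by simp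
  have CD: "C h \<le> D" if "h \<in> T" for h
    using member_le_sum[of h T C] that C0 T(1) by (auto simp: D_def)
  obtain K where K: "K \<ge> 0" and Kb: "\<And>w::complex. norm w \<le> 1 \<Longrightarrow> norm ((1 + w) ^ n - (1 + of_nat n * w)) \<le> K * (norm w)\<^sup>2"
    using power_one_plus_bound by blast
  define S where "S = (\<Sum>f\<in>F. - ln (norm (hchar M f)))"
  define A where "A = D * real (card F) + 1 + K * D\<^sup>2 * real (card F) * \<bar>S\<bar>"
  have A1: "A \<ge> 1" unfolding A_def using D1 K by simp
  \<comment> \<open>\<open>\<delta> \<le> 1/2\<close> keeps the factors away from zero, \<open>D * card F * \<delta> \<le> 1\<close> keeps the deviations in the
    range of the quadratic estimate, and the last summand of \<open>A\<close> makes the total error at most \<open>\<epsilon>\<close>.\<close>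
  define \<delta> where "\<delta> = min (1/2) (min 1 \<epsilon> / A)"
  have \<delta>: "\<delta> > 0" "\<delta> \<le> 1/2" unfolding \<delta>_def using \<epsilon> A1 min.cobounded1 by (simp, blast)
  have "\<delta> * A \<le> min 1 \<epsilon>"
    using mult_right_mono[of \<delta> "min 1 \<epsilon> / A" A] A1 by (simp add: \<delta>_def)
  moreover have "D * real (card F) * \<delta> \<le> \<delta> * A" "K * D\<^sup>2 * real (card F) * \<bar>S\<bar> * \<delta> \<le> \<delta> * A"
    unfolding A_def using \<delta>(1) D1 K by (simp_all add: algebra_simps)
  ultimately have \<delta>1: "D * real (card F) * \<delta> \<le> 1" and \<delta>2: "K * D\<^sup>2 * real (card F) * \<bar>S\<bar> * \<delta> \<le> \<epsilon>" by linarith+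
  from null \<delta>(1) obtain N \<nu>
    where N: "(\<forall>k<N. borel_prob (\<nu> k) \<and> (\<forall>f\<in>F. norm (hchar (\<nu> k) f - 1) \<le> \<delta>)) \<and>
      (\<forall>h. hchar M h = (\<Prod>k<(N::nat). hchar (\<nu> k) h))"
    unfolding null_array_def by presburger
  have \<nu>: "\<And>k. k < N \<Longrightarrow> borel_prob (\<nu> k)"
    and small: "\<And>k f. k < N \<Longrightarrow> f \<in> F \<Longrightarrow> norm (hchar (\<nu> k) f - 1) \<le> \<delta>"
    and prod: "\<And>h. hchar M h = (\<Prod>k<N. hchar (\<nu> k) h)"
    using N by blast+
  define e where "e k = (\<Sum>f\<in>F. 1 - norm (hchar (\<nu> k) f))" for k
  have low: "1 - \<delta> \<le> norm (hchar (\<nu> k) f)" if "k < N" "f \<in> F" for k f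
    using small[OF that] norm_triangle_ineq2[of 1 "hchar (\<nu> k) f"] by (simp add: norm_minus_commute)
  have pos: "0 < norm (hchar (\<nu> k) f)" if "k < N" "f \<in> F" for k f
    using low[OF that] \<delta>(2) by linarith
  have e0: "0 \<le> e k" if "k < N" for k
    unfolding e_def by (intro sum_nonneg) (use norm_hchar_le_1[OF \<nu>[OF that]] in auto)
  have e\<delta>: "e k \<le> real (card F) * \<delta>" if "k < N" for k
    unfolding e_def using sum_bounded_above[of F "\<lambda>f. 1 - norm (hchar (\<nu> k) f)" \<delta>] low[OF that] by force
  \<comment> \<open>The inequality \<open>1 - x \<le> - ln x\<close> makes the sum of the deviations telescope to the logarithm of
    \<open>hchar M\<close>, which does not depend on the array.\<close>
  have eS: "(\<Sum>k<N. e k) \<le> \<bar>S\<bar>"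
  proof -
    have "(\<Sum>k<N. e k) = (\<Sum>f\<in>F. \<Sum>k<N. 1 - norm (hchar (\<nu> k) f))"
      unfolding e_def by (rule sum.swap)
    also have "\<dots> \<le> (\<Sum>f\<in>F. - ln (norm (hchar M f)))"
    proof (rule sum_mono)
      fix f assume f: "f \<in> F"
      have "ln (norm (hchar M f)) = (\<Sum>k<N. ln (norm (hchar (\<nu> k) f)))"
        unfolding prod prod_norm[symmetric] by (rule ln_prod) (use pos f in auto)
      moreover have "1 - norm (hchar (\<nu> k) f) \<le> - ln (norm (hchar (\<nu> k) f))" if "k < N" for k
        using ln_le_minus_one[OF pos[OF that f]] by simp
      then have "(\<Sum>k<N. 1 - norm (hchar (\<nu> k) f)) \<le> (\<Sum>k<N. - ln (norm (hchar (\<nu> k) f)))"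
        by (intro sum_mono) auto
      ultimately show "(\<Sum>k<N. 1 - norm (hchar (\<nu> k) f)) \<le> - ln (norm (hchar M f))"
        by (simp add: sum_negf)
    qed
    finally show ?thesis unfolding S_def by linarith
  qed
  \<comment> \<open>The approximate root of a single factor.\<close>
  have piece: "\<exists>\<tau>. borel_prob \<tau> \<and> (\<forall>h\<in>T. norm (hchar \<tau> h ^ n - hchar (\<nu> k) h) \<le> K * D\<^sup>2 * real (card F) * \<delta> * e k)"
    if k: "k < N" for k
  proof -
    obtain a where a: "\<And>f. f \<in> F \<Longrightarrow> hchar (\<nu> k) f = of_real (norm (hchar (\<nu> k) f)) * cis (a \<bullet> f)"
      using exists_centering[OF \<nu>[OF k] F orth] by blast
    define \<nu>' where "\<nu>' = distr (\<nu> k) borel (\<lambda>x. x + - a)"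
    have tm: "(\<lambda>x. x + c) \<in> measurable borel borel" for c :: 'a
      by (intro borel_measurable_continuous_onI continuous_intros)
    have \<nu>': "borel_prob \<nu>'" unfolding \<nu>'_def by (rule borel_prob_distr[OF \<nu>[OF k] tm])
    have h\<nu>': "hchar \<nu>' h = cis (- (a \<bullet> h)) * hchar (\<nu> k) h" for h
      unfolding \<nu>'_def hchar_translate[OF \<nu>[OF k]] by simp
    have norm': "norm (hchar \<nu>' h) = norm (hchar (\<nu> k) h)" for h by (simp add: h\<nu>' norm_mult)
    have real': "hchar \<nu>' f = of_real (norm (hchar \<nu>' f))" if "f \<in> F" for f
      unfolding norm' unfolding h\<nu>' by (subst a[OF that]) (simp add: cis_mult mult.left_commute)
    obtain \<theta> where \<theta>: "borel_prob \<theta>" "\<And>h. hchar \<theta> h = 1 + of_real (1 / real n) * (hchar \<nu>' h - 1)"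
      using exists_thinning[OF \<nu>', of "1 / real n"] n by auto
    define \<tau> where "\<tau> = distr \<theta> borel (\<lambda>x. x + a /\<^sub>R real n)"
    have \<tau>: "borel_prob \<tau>" unfolding \<tau>_def by (rule borel_prob_distr[OF \<theta>(1) tm])
    moreover have "norm (hchar \<tau> h ^ n - hchar (\<nu> k) h) \<le> K * D\<^sup>2 * real (card F) * \<delta> * e k" if h: "h \<in> T" for h
    proof -
      define z where "z = hchar \<nu>' h - 1"
      define w where "w = z / of_nat n"
      have "norm z \<le> C h * e k"
        unfolding z_def e_def using centered_hchar_bound[OF \<nu>' F real' b[OF h]] by (simp add: norm')
      also have "\<dots> \<le> D * e k" using CD[OF h] e0[OF k] by (rule mult_right_mono)
      finally have z: "norm z \<le> D * e k" .
      have "norm w \<le> norm z" unfolding w_def using n by (simp add: norm_divide divide_le_eq mult_le_cancel_left1)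
      then have w: "norm w \<le> D * e k" using z by simp
      also have "\<dots> \<le> D * (real (card F) * \<delta>)" using e\<delta>[OF k] D1 by (intro mult_left_mono) auto
      also have "\<dots> \<le> 1" using \<delta>1 by (simp add: mult.assoc)
      finally have w1: "norm w \<le> 1" .
      have cis_n: "cis ((a /\<^sub>R real n) \<bullet> h) ^ n = cis (a \<bullet> h)"
        using n by (simp add: Complex.DeMoivre mult.assoc[symmetric])
      have "hchar \<tau> h = cis ((a /\<^sub>R real n) \<bullet> h) * (1 + w)"
        unfolding \<tau>_def hchar_translate[OF \<theta>(1)] \<theta>(2) by (simp add: w_def z_def)
      then have 1: "hchar \<tau> h ^ n = cis (a \<bullet> h) * (1 + w) ^ n"
        by (simp only: power_mult_distrib cis_n)
      have "cis (a \<bullet> h) * (1 + of_nat n * w) = cis (a \<bullet> h) * hchar \<nu>' h" using n by (simp add: w_def z_def)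
      also have "\<dots> = hchar (\<nu> k) h" by (simp add: h\<nu>' mult.assoc[symmetric] cis_mult)
      finally have 2: "hchar (\<nu> k) h = cis (a \<bullet> h) * (1 + of_nat n * w)" ..
      have "norm (hchar \<tau> h ^ n - hchar (\<nu> k) h) = norm ((1 + w) ^ n - (1 + of_nat n * w))"
        unfolding 1 2 right_diff_distrib[symmetric] norm_mult by simp
      also have "\<dots> \<le> K * (norm w)\<^sup>2" by (rule Kb[OF w1])
      also have "\<dots> \<le> K * ((D * e k) * (D * (real (card F) * \<delta>)))"
      proof (rule mult_left_mono[OF _ K])
        have "(norm w)\<^sup>2 = norm w * norm w" by (simp add: power2_eq_square)
        also have "\<dots> \<le> (D * e k) * (D * (real (card F) * \<delta>))"
          by (rule mult_mono[OF w order_trans[OF w mult_left_mono[OF e\<delta>[OF k]]]]) (use D1 e0[OF k] in auto)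
        finally show "(norm w)\<^sup>2 \<le> (D * e k) * (D * (real (card F) * \<delta>))" .
      qed
      finally show ?thesis by (simp add: power2_eq_square mult_ac)
    qed
    ultimately show ?thesis by blast
  qed
  then have "\<forall>k\<in>{..<N}. \<exists>\<tau>. borel_prob \<tau> \<and> (\<forall>h\<in>T. norm (hchar \<tau> h ^ n - hchar (\<nu> k) h) \<le> K * D\<^sup>2 * real (card F) * \<delta> * e k)"
    by blast
  from bchoice[OF this] obtain t where t: "\<And>k. k < N \<Longrightarrow> borel_prob (t k)"
    and tb: "\<And>k h. k < N \<Longrightarrow> h \<in> T \<Longrightarrow> norm (hchar (t k) h ^ n - hchar (\<nu> k) h) \<le> K * D\<^sup>2 * real (card F) * \<delta> * e k"
    by blast
  obtain \<tau> where \<tau>: "borel_prob \<tau>" and h\<tau>: "\<And>h. hchar \<tau> h = (\<Prod>k<N. hchar (t k) h)"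
    using exists_conv_prod[of N t] t by blast
  have "norm (hchar \<tau> h ^ n - hchar M h) \<le> \<epsilon>" if h: "h \<in> T" for h
  proof -
    have "norm (hchar \<tau> h ^ n - hchar M h) = norm ((\<Prod>k<N. hchar (t k) h ^ n) - (\<Prod>k<N. hchar (\<nu> k) h))"
      unfolding h\<tau> prod by (simp add: prod_power_distrib)
    also have "\<dots> \<le> (\<Sum>k<N. norm (hchar (t k) h ^ n - hchar (\<nu> k) h))"
      by (rule norm_prod_diff) (use norm_hchar_le_1[OF t] norm_hchar_le_1[OF \<nu>] in \<open>auto simp: norm_power intro!: power_le_one\<close>)
    also have "\<dots> \<le> (\<Sum>k<N. K * D\<^sup>2 * real (card F) * \<delta> * e k)"
      by (rule sum_mono) (use tb h in auto)
    also have "\<dots> = K * D\<^sup>2 * real (card F) * \<delta> * (\<Sum>k<N. e k)" by (simp add: sum_distrib_left)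
    also have "\<dots> \<le> K * D\<^sup>2 * real (card F) * \<delta> * \<bar>S\<bar>"
      using eS K \<delta>(1) by (intro mult_left_mono) auto
    also have "\<dots> \<le> \<epsilon>" using \<delta>2 by (simp add: mult_ac)
    finally show ?thesis .
  qed
  then show ?thesis using that \<tau> by blast
qed

section \<open>Orthogonal systems and rational frequencies\<close>

text \<open>
  The vectors are orthogonal but not normalized, and vanish whenever \<open>e k\<close> depends linearly on its predecessors; the
  quotients for such vectors are 0 by convention.
\<close>
fun gram_schmidt :: "(nat \<Rightarrow> 'a::real_inner) \<Rightarrow> nat \<Rightarrow> 'a" where
  "gram_schmidt e k = e k - (\<Sum>l<k. ((e k \<bullet> gram_schmidt e l) / (gram_schmidt e l \<bullet> gram_schmidt e l)) *\<^sub>R gram_schmidt e l)"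

declare gram_schmidt.simps [simp del]

lemma gram_schmidt_orthogonal: "l < k \<Longrightarrow> gram_schmidt e k \<bullet> gram_schmidt e l = 0"
proof (induction k arbitrary: l rule: less_induct)
  case (less k)
  let ?u = "gram_schmidt e"
  have zero: "?u m \<bullet> ?u l = 0" if "m < k" "m \<noteq> l" for m
  proof (cases "m < l")
    case True
    then show ?thesis using less.IH[OF less.prems] by (metis inner_commute)
  next
    case False
    then show ?thesis using less.IH[of m l] that by simp
  qed
  have "?u k \<bullet> ?u l = e k \<bullet> ?u l - (\<Sum>m<k. ((e k \<bullet> ?u m) / (?u m \<bullet> ?u m)) * (?u m \<bullet> ?u l))"
    by (subst gram_schmidt.simps[of e k]) (simp add: inner_diff_left inner_sum_left)
  also have "(\<Sum>m<k. ((e k \<bullet> ?u m) / (?u m \<bullet> ?u m)) * (?u m \<bullet> ?u l)) = ((e k \<bullet> ?u l) / (?u l \<bullet> ?u l)) * (?u l \<bullet> ?u l)"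
    using less.prems by (subst sum.remove[of _ l]) (auto intro!: sum.neutral simp: zero)
  also have "\<dots> = e k \<bullet> ?u l" by (cases "?u l = 0") simp_all
  finally show ?case by simp
qed

lemma inner_gram_schmidt_zero:
  assumes "\<And>k. x \<bullet> gram_schmidt e k = 0" shows "x \<bullet> e k = 0"
proof -
  have "e k = gram_schmidt e k + (\<Sum>l<k. ((e k \<bullet> gram_schmidt e l) / (gram_schmidt e l \<bullet> gram_schmidt e l)) *\<^sub>R gram_schmidt e l)"
    by (subst gram_schmidt.simps) simp
  then have "x \<bullet> e k = x \<bullet> gram_schmidt e k + (\<Sum>l<k. ((e k \<bullet> gram_schmidt e l) / (gram_schmidt e l \<bullet> gram_schmidt e l)) * (x \<bullet> gram_schmidt e l))"
    by (metis (no_types, lifting) inner_add_right inner_scaleR_right inner_sum_right sum.cong)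
  then show ?thesis using assms by simp
qed

text \<open>
  The factorials make the grids increasing in \<open>j\<close> and their union divisible.
\<close>
definition grid :: "(nat \<Rightarrow> 'a::real_vector) \<Rightarrow> nat \<Rightarrow> 'a set" where
  "grid u j = {\<Sum>l<j. of_int (m l) *\<^sub>R (u l /\<^sub>R fact j) | m :: nat \<Rightarrow> int. True}"

lemma countable_integer_combinations:
  "countable {\<Sum>l<(j::nat). of_int (m l) *\<^sub>R (w l :: 'a::real_vector) | m :: nat \<Rightarrow> int. True}"
proof (induction j)
  case 0 then show ?case by simp
next
  case (Suc j)
  let ?S = "{\<Sum>l<j. of_int (m l) *\<^sub>R w l | m :: nat \<Rightarrow> int. True}"
  have "{\<Sum>l<Suc j. of_int (m l) *\<^sub>R w l | m :: nat \<Rightarrow> int. True} \<subseteq> (\<lambda>(x, z::int). x + of_int z *\<^sub>R w j) ` (?S \<times> UNIV)"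
  proof
    fix x assume "x \<in> {\<Sum>l<Suc j. of_int (m l) *\<^sub>R w l | m :: nat \<Rightarrow> int. True}"
    then obtain m :: "nat \<Rightarrow> int" where "x = (\<Sum>l<j. of_int (m l) *\<^sub>R w l) + of_int (m j) *\<^sub>R w j" by auto
    then show "x \<in> (\<lambda>(x, z::int). x + of_int z *\<^sub>R w j) ` (?S \<times> UNIV)"
      by (intro image_eqI[of _ _ "(\<Sum>l<j. of_int (m l) *\<^sub>R w l, m j)"]) auto
  qed
  moreover have "countable ((\<lambda>(x, z::int). x + of_int z *\<^sub>R w j) ` (?S \<times> UNIV))"
    using Suc by (intro countable_image countable_SIGMA) auto
  ultimately show ?case by (rule countable_subset)
qed

lemma grid_add:
  assumes "x \<in> grid u j" "y \<in> grid u j" shows "x + y \<in> grid u j"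
proof -
  obtain m m' :: "nat \<Rightarrow> int" where "x = (\<Sum>l<j. of_int (m l) *\<^sub>R (u l /\<^sub>R fact j))" "y = (\<Sum>l<j. of_int (m' l) *\<^sub>R (u l /\<^sub>R fact j))"
    using assms by (auto simp: grid_def)
  then have "x + y = (\<Sum>l<j. of_int (m l + m' l) *\<^sub>R (u l /\<^sub>R fact j))"
    by (simp only: of_int_add scaleR_add_left sum.distrib)
  then show ?thesis unfolding grid_def by (intro CollectI exI[of _ "\<lambda>l. m l + m' l"]) simp
qed

lemma grid_uminus:
  assumes "x \<in> grid u j" shows "- x \<in> grid u j"
proof -
  obtain m :: "nat \<Rightarrow> int" where "x = (\<Sum>l<j. of_int (m l) *\<^sub>R (u l /\<^sub>R fact j))"
    using assms by (auto simp: grid_def)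
  then have "- x = (\<Sum>l<j. of_int (- m l) *\<^sub>R (u l /\<^sub>R fact j))" by (simp add: sum_negf)
  then show ?thesis unfolding grid_def by (intro CollectI exI[of _ "\<lambda>l. - m l"]) simp
qed

lemma grid_refine:
  assumes x: "x \<in> grid u j" and le: "j \<le> j'" and n: "n \<ge> 1" and dvd: "n * fact j dvd (fact j' :: nat)"
  shows "x /\<^sub>R real n \<in> grid u j'"
proof -
  obtain m :: "nat \<Rightarrow> int" where m: "x = (\<Sum>l<j. of_int (m l) *\<^sub>R (u l /\<^sub>R fact j))"
    using x by (auto simp: grid_def)
  obtain q where q: "(fact j' :: nat) = n * fact j * q" using dvd by auto
  have "(fact j' :: real) = real (fact j')" by simp
  also have "\<dots> = real n * fact j * real q" unfolding q by simp
  finally have qr: "(fact j' :: real) = real n * fact j * real q" .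
  have "q > 0" using q by (intro Nat.gr0I) auto
  then have c: "real q / fact j' = 1 / (real n * fact j)" unfolding qr using n by (simp add: field_simps)
  define m' where "m' l = (if l < j then m l * int q else 0)" for l
  have "(\<Sum>l<j'. of_int (m' l) *\<^sub>R (u l /\<^sub>R fact j')) = (\<Sum>l<j. of_int (m' l) *\<^sub>R (u l /\<^sub>R fact j'))"
    using le by (intro sum.mono_neutral_right) (auto simp: m'_def)
  also have "\<dots> = (\<Sum>l<j. (of_int (m l) *\<^sub>R (u l /\<^sub>R fact j)) /\<^sub>R real n)"
  proof (rule sum.cong[OF refl])
    fix l assume "l \<in> {..<j}"
    then have "of_int (m' l) *\<^sub>R (u l /\<^sub>R fact j') = (of_int (m l) * (real q / fact j')) *\<^sub>R u l"
      by (simp add: m'_def divide_inverse mult.assoc)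
    also have "\<dots> = (of_int (m l) *\<^sub>R (u l /\<^sub>R fact j)) /\<^sub>R real n"
      unfolding c by (simp add: divide_inverse mult_ac)
    finally show "of_int (m' l) *\<^sub>R (u l /\<^sub>R fact j') = (of_int (m l) *\<^sub>R (u l /\<^sub>R fact j)) /\<^sub>R real n" .
  qed
  also have "\<dots> = x /\<^sub>R real n" unfolding m by (simp add: scaleR_sum_right)
  finally show ?thesis unfolding grid_def by (intro CollectI exI[of _ m']) simp
qed

lemma grid_mono:
  assumes "x \<in> grid u j" "j \<le> j'" shows "x \<in> grid u j'"
proof -
  have "1 * fact j dvd (fact j' :: nat)" unfolding mult_1 by (rule fact_dvd[OF assms(2)])
  from grid_refine[OF assms _ this] show ?thesis by simp
qed

text \<open>
  The frequencies are the rational combinations of an orthogonal system obtained from a dense sequence. Finitely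
  many of them lie in a common grid, which is generated by finitely many orthogonal vectors, as the centering
  requires.
\<close>
lemma exists_frequency_group:
  obtains d :: "nat \<Rightarrow> 'a::{real_inner, polish_space}"
  where "frequency_group d"
    "\<And>T. finite T \<Longrightarrow> \<exists>F. finite F \<and> pairwise (\<lambda>f g. f \<bullet> g = 0) F \<and> (\<forall>i\<in>T. first_order F (d i))"
proof -
  obtain E :: "'a set" where E: "countable E" "\<And>X. open X \<Longrightarrow> X \<noteq> {} \<Longrightarrow> \<exists>e\<in>E. e \<in> X"
    using countable_dense_setE by blast
  have "E \<noteq> {}" using E(2)[of UNIV] by auto
  define u where "u = gram_schmidt (from_nat_into E)"
  have sep: "x = 0" if x: "\<And>l. x \<bullet> u l = 0" for x
  proof (rule ccontr)
    assume "x \<noteq> 0"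
    have "open {y. 0 < x \<bullet> y}" by (intro open_Collect_less continuous_intros)
    moreover have "x \<in> {y. 0 < x \<bullet> y}" using \<open>x \<noteq> 0\<close> by simp
    ultimately obtain e where e: "e \<in> E" "0 < x \<bullet> e" using E(2)[of "{y. 0 < x \<bullet> y}"] by blast
    then obtain k where "e = from_nat_into E k"
      using from_nat_into_surj[OF E(1)] by metis
    then show False using inner_gram_schmidt_zero[of x "from_nat_into E" k] x e by (simp add: u_def)
  qed
  define D where "D = (\<Union>j. grid u j)"
  have "countable D" unfolding D_def grid_def by (intro countable_UN countable_integer_combinations) auto
  have D0: "0 \<in> D" unfolding D_def grid_def by (intro UN_I[of 0] CollectI exI[of _ "\<lambda>_. 0"]) auto
  define d where "d = from_nat_into D"
  have range: "range d = D" unfolding d_def using range_from_nat_into[OF _ \<open>countable D\<close>] D0 by blast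
  have dD: "d i \<in> D" for i using range by auto
  have uD: "u l \<in> D" for l
  proof -
    have "(\<Sum>i<Suc l. of_int (if i = l then fact (Suc l) else 0) *\<^sub>R (u i /\<^sub>R fact (Suc l))) = u l"
      by (simp add: sum.neutral del: fact_Suc)
    then show ?thesis unfolding D_def grid_def
      by (intro UN_I[of "Suc l"] CollectI exI[of _ "\<lambda>i. if i = l then fact (Suc l) else 0"]) auto
  qed
  have "frequency_group d"
  proof
    show "0 \<in> range d" using range D0 by simp
    show "d i + d j \<in> range d" for i j
    proof -
      obtain a b where "d i \<in> grid u a" "d j \<in> grid u b" using dD unfolding D_def by blast
      then have "d i + d j \<in> grid u (max a b)" by (intro grid_add) (auto elim: grid_mono)
      then show ?thesis unfolding range D_def by blast
    qed
    show "- d i \<in> range d" for i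
      using dD[of i] grid_uminus unfolding range D_def by blast
    show "\<exists>k. d i = real n *\<^sub>R d k" if n: "n \<ge> 1" for i n
    proof -
      obtain j where j: "d i \<in> grid u j" using dD unfolding D_def by blast
      have "j \<le> fact j" by (rule fact_ge_self)
      also have "\<dots> \<le> n * fact j" using n by simp
      finally have le: "j \<le> n * fact j" .
      have "n * fact j dvd (fact (n * fact j) :: nat)" using n by (intro dvd_fact) auto
      from grid_refine[OF j le n this] have "d i /\<^sub>R real n \<in> range d" unfolding range D_def by blast
      then obtain k where "d i /\<^sub>R real n = d k" by auto
      then have "d i = real n *\<^sub>R d k" using n by (metis divideR_right not_one_le_zero of_nat_eq_0_iff)
      then show ?thesis by blast
    qed
    show "x = 0" if "\<And>i. x \<bullet> d i = 0" for x
    proof (rule sep)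
      fix l
      have "u l \<in> range d" using uD range by simp
      then show "x \<bullet> u l = 0" using that by auto
    qed
  qed
  moreover have "\<exists>F. finite F \<and> pairwise (\<lambda>f g. f \<bullet> g = 0) F \<and> (\<forall>i\<in>T. first_order F (d i))" if T: "finite T" for T
  proof -
    have "\<exists>j. d i \<in> grid u j" for i using dD unfolding D_def by blast
    then obtain J where J: "\<And>i. d i \<in> grid u (J i)" by metis
    define j where "j = Max (insert 0 (J ` T))"
    have dj: "d i \<in> grid u j" if "i \<in> T" for i
      using grid_mono[OF J] T that by (simp add: j_def)
    let ?F = "(\<lambda>l. u l /\<^sub>R fact j) ` {..<j}"
    have orth: "u a \<bullet> u b = 0" if "a \<noteq> b" for a b
      using gram_schmidt_orthogonal[of a b] gram_schmidt_orthogonal[of b a] that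
      by (metis inner_commute linorder_neqE_nat u_def)
    have "pairwise (\<lambda>f g. f \<bullet> g = 0) ?F"
    proof (rule pairwiseI)
      fix f g assume "f \<in> ?F" "g \<in> ?F" "f \<noteq> g"
      then obtain a b where "f = u a /\<^sub>R fact j" "g = u b /\<^sub>R fact j" "a \<noteq> b" by blast
      then show "f \<bullet> g = 0" using orth by simp
    qed
    moreover have "first_order ?F (d i)" if i: "i \<in> T" for i
    proof -
      obtain m :: "nat \<Rightarrow> int" where "d i = (\<Sum>l<j. of_int (m l) *\<^sub>R (u l /\<^sub>R fact j))"
        using dj[OF i] by (auto simp: grid_def)
      then show ?thesis using first_order_lattice[of ?F j "\<lambda>l. u l /\<^sub>R fact j" m] by simp
    qed
    ultimately show ?thesis by (intro exI[of _ ?F]) auto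
  qed
  ultimately show ?thesis using that by blast
qed

section \<open>Infinite divisibility\<close>

text \<open>
  Approximate roots along an increasing sequence of finite sets of frequencies, with errors tending to 0, satisfy
  the hypotheses of \<open>conv_root_of_hchar_limit\<close>.
\<close>
theorem infinitely_divisible_if_null_arrays:
  fixes M :: "'a::{real_inner, polish_space} measure"
  assumes M: "borel_prob M" and null: "\<And>F. finite F \<Longrightarrow> null_array M F"
  shows "infinitely_divisible M"
  unfolding infinitely_divisible_def
proof (intro conjI allI impI)
  show "prob_space M" "sets M = sets borel" using M by auto
  fix n :: nat assume n: "1 \<le> n"
  obtain d :: "nat \<Rightarrow> 'a" where "frequency_group d" and
    d: "\<And>T. finite T \<Longrightarrow> \<exists>F. finite F \<and> pairwise (\<lambda>f g. f \<bullet> g = 0) F \<and> (\<forall>i\<in>T. first_order F (d i))"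
    using exists_frequency_group by blast
  interpret frequency_group d by fact
  have "\<exists>\<tau>. borel_prob \<tau> \<and> (\<forall>i\<le>j. norm (hchar \<tau> (d i) ^ n - hchar M (d i)) \<le> 1 / real (Suc j))" for j
  proof -
    obtain F where F: "finite F" "pairwise (\<lambda>f g. f \<bullet> g = 0) F" "\<forall>i\<in>{..j}. first_order F (d i)"
      using d[of "{..j}"] by blast
    obtain \<tau> where "borel_prob \<tau>" "\<And>h. h \<in> d ` {..j} \<Longrightarrow> norm (hchar \<tau> h ^ n - hchar M h) \<le> 1 / real (Suc j)"
      using approximate_root[OF null[OF F(1)] F(1,2) n, of "d ` {..j}" "1 / real (Suc j)"] F(3) by auto
    then show ?thesis by auto
  qed
  then obtain \<tau> where \<tau>: "\<And>j. borel_prob (\<tau> j)"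
    and b: "\<And>j i. i \<le> j \<Longrightarrow> norm (hchar (\<tau> j) (d i) ^ n - hchar M (d i)) \<le> 1 / real (Suc j)" by metis
  have "(\<lambda>j. hchar (\<tau> j) (d i) ^ n) \<longlonglongrightarrow> hchar M (d i)" for i
  proof (rule LIM_zero_cancel, rule Lim_null_comparison)
    show "\<forall>\<^sub>F j in sequentially. norm (hchar (\<tau> j) (d i) ^ n - hchar M (d i)) \<le> 1 / real (Suc j)"
      by (rule eventually_sequentiallyI[of i]) (rule b)
    show "(\<lambda>j. 1 / real (Suc j)) \<longlonglongrightarrow> 0"
      using LIMSEQ_Suc[OF lim_const_over_n[of "1::real"]] by simp
  qed
  from conv_root_of_hchar_limit[OF M n \<tau> this]
  show "\<exists>N. prob_space N \<and> sets N = sets borel \<and> M = measure_conv_power n N" by metis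
qed

section \<open>Null arrays of an evolution family\<close>

text \<open>
  The theorem of Banach and Steinhaus, by Baire's theorem for the closed sets on which all \<open>T i x\<close> are bounded by \<open>n\<close>.
\<close>
lemma uniform_boundedness:
  fixes T :: "'i \<Rightarrow> 'a::{real_normed_vector, complete_space} \<Rightarrow>\<^sub>L 'b::real_normed_vector"
  assumes pt: "\<And>x. \<exists>B. \<forall>i\<in>I. norm (T i x) \<le> B"
  obtains B where "B \<ge> 0" "\<And>i. i \<in> I \<Longrightarrow> norm (T i) \<le> B"
proof -
  define A where "A n = {x. \<forall>i\<in>I. norm (T i x) \<le> real n}" for n
  have closed: "closed (A n)" for n
  proof -
    have "A n = (\<Inter>i\<in>I. {x. norm (T i x) \<le> real n})" by (auto simp: A_def)
    also have "closed \<dots>" by (intro closed_INT ballI closed_Collect_le continuous_intros)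
    finally show ?thesis .
  qed
  have "(\<Union>n. A n) = UNIV"
  proof (rule equalityI[OF subset_UNIV], rule subsetI)
    fix x
    obtain B where B: "\<forall>i\<in>I. norm (T i x) \<le> B" using pt by blast
    obtain n where "B \<le> real n" using real_arch_simple by blast
    then have "x \<in> A n" unfolding A_def using B by (blast intro: order_trans)
    then show "x \<in> (\<Union>n. A n)" by blast
  qed
  moreover have "interior (\<Union>n. A n) = {}" if "\<And>n. interior (A n) = {}"
    using Baire_category_alt[of "euclidean :: 'a topology" "range A"] completely_metrizable_space_euclidean closed that
    by auto
  ultimately obtain n where "interior (A n) \<noteq> {}" by (metis UNIV_not_empty interior_UNIV)
  then obtain x0 where "x0 \<in> interior (A n)" by blast
  then obtain r where r: "r > 0" and ball: "cball x0 r \<subseteq> A n" using mem_interior_cball by blast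
  have bound: "norm (T i y) \<le> (2 * real n / r) * norm y" if i: "i \<in> I" for i y
  proof (cases "y = 0")
    case False
    define z where "z = (r / norm y) *\<^sub>R y"
    have "norm z = r" using False r by (simp add: z_def)
    then have "x0 + z \<in> A n" "x0 \<in> A n" using ball r by (auto simp: dist_norm)
    then have "norm (T i (x0 + z)) \<le> n" "norm (T i x0) \<le> n" using i by (auto simp: A_def)
    moreover have "T i z = T i (x0 + z) - T i x0" by (simp add: blinfun.add_right)
    ultimately have "norm (T i z) \<le> 2 * real n"
      using norm_triangle_ineq4[of "T i (x0 + z)" "T i x0"] by simp
    moreover have "norm (T i z) = (r / norm y) * norm (T i y)"
      using r by (simp add: z_def blinfun.scaleR_right)
    ultimately show ?thesis using r False by (simp add: field_simps)
  qed simp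
  show ?thesis
  proof
    show "0 \<le> 2 * real n / r" using r by simp
    show "norm (T i) \<le> 2 * real n / r" if "i \<in> I" for i
      using bound[OF that] r by (intro norm_blinfun_bound) auto
  qed
qed

lemma evolution_family_bounded:
  fixes U :: "real \<Rightarrow> real \<Rightarrow> ('a::{real_normed_vector, complete_space} \<Rightarrow>\<^sub>L 'a)"
  assumes U: "evolution_family U"
  obtains B where "B \<ge> 0" "\<And>r. s \<le> r \<Longrightarrow> r \<le> t \<Longrightarrow> norm (U t r) \<le> B"
proof -
  have "\<exists>B. \<forall>r\<in>{s..t}. norm (U t r x) \<le> B" for x
  proof -
    have "continuous_on {(t, s). s \<le> t} (\<lambda>(t, s). U t s x)" using U by (simp add: evolution_family_def)
    then have "continuous_on {s..t} (\<lambda>r. (\<lambda>(t, s). U t s x) (t, r))"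
      by (rule continuous_on_compose2) (auto intro!: continuous_intros)
    then have "compact ((\<lambda>r. U t r x) ` {s..t})" by (intro compact_continuous_image) auto
    then show ?thesis using compact_imp_bounded bounded_iff by (metis imageI)
  qed
  then obtain B where "B \<ge> 0" "\<And>r. r \<in> {s..t} \<Longrightarrow> norm (U t r) \<le> B"
    using uniform_boundedness[of "{s..t}" "U t"] by blast
  then show ?thesis using that by simp
qed

text \<open>
  Convergence to the point mass at 0, measured by the mean of \<open>min 1 (norm x)\<close>, carries over to the
  characteristic function of the image under \<open>A\<close>, uniformly for operators of bounded norm.
\<close>
lemma char_deviation_le:
  fixes A :: "'a::real_inner \<Rightarrow>\<^sub>L 'a"
  assumes M: "borel_prob M" and A: "norm A \<le> B"
  shows "norm ((\<integral>x. cis (A x \<bullet> h) \<partial>M) - 1) \<le> max 2 (B * norm h) * (\<integral>x. min 1 (norm x) \<partial>M)"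
proof -
  interpret prob_space M using M by simp
  have [measurable_cong]: "sets M = sets borel" using M by simp
  have m: "(\<lambda>x. A x \<bullet> h) \<in> borel_measurable borel"
    by (intro borel_measurable_continuous_onI continuous_intros)
  have ci: "integrable M (\<lambda>x. cis (A x \<bullet> h))" by (rule integrable_cis[OF M m])
  have mi: "integrable M (\<lambda>x. min 1 (norm x))"
    by (rule integrable_const_bound[of _ 1]) auto
  have B0: "0 \<le> B" using A norm_ge_zero order_trans by blast
  have pt: "norm (cis (A x \<bullet> h) - 1) \<le> max 2 (B * norm h) * min 1 (norm x)" for x
  proof -
    have "norm (cis (A x \<bullet> h) - 1) \<le> 2" by (rule order_trans[OF norm_triangle_ineq4]) simp
    moreover have "norm (cis (A x \<bullet> h) - 1) \<le> B * norm h * norm x"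
    proof -
      have "norm (cis (A x \<bullet> h) - 1) \<le> \<bar>A x \<bullet> h\<bar>"
        using iexp_approx1[of "A x \<bullet> h" 0] by (simp add: cis_conv_exp)
      also have "\<dots> \<le> norm (A x) * norm h" by (rule Cauchy_Schwarz_ineq2)
      also have "\<dots> \<le> (B * norm x) * norm h"
        by (intro mult_right_mono order_trans[OF norm_blinfun] A) auto
      finally show ?thesis by (simp add: mult_ac)
    qed
    moreover have "B * norm h * norm x \<le> max 2 (B * norm h) * norm x" by (intro mult_right_mono) auto
    ultimately show ?thesis by (auto simp: min_def)
  qed
  have "(\<integral>x. cis (A x \<bullet> h) \<partial>M) - 1 = (\<integral>x. cis (A x \<bullet> h) - 1 \<partial>M)"
    using ci by (simp add: prob_space)
  also have "norm \<dots> \<le> (\<integral>x. norm (cis (A x \<bullet> h) - 1) \<partial>M)" by (rule integral_norm_bound)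
  also have "\<dots> \<le> (\<integral>x. max 2 (B * norm h) * min 1 (norm x) \<partial>M)"
    using ci mi pt by (intro integral_mono) auto
  finally show ?thesis by simp
qed

lemma weakly_converges_point_mass_min_norm:
  fixes M :: "'i \<Rightarrow> 'a::real_normed_vector measure"
  assumes "weakly_converges M (return borel 0) F"
  shows "((\<lambda>i. \<integral>x. min 1 (norm x) \<partial>M i) \<longlongrightarrow> 0) F"
proof -
  have "continuous_on UNIV (\<lambda>x::'a. min 1 (norm x))" by (intro continuous_intros)
  moreover have "bounded (range (\<lambda>x::'a. min 1 (norm x)))" by (rule boundedI[of _ 1]) auto
  ultimately have "((\<lambda>i. \<integral>x. min 1 (norm x) \<partial>M i) \<longlongrightarrow> (\<integral>x. min 1 (norm x) \<partial>return borel (0::'a))) F"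
    using assms unfolding weakly_converges_def by blast
  moreover have "(\<integral>x. min 1 (norm x) \<partial>return borel (0::'a)) = 0"
    by (subst integral_return) auto
  ultimately show ?thesis by simp
qed

text \<open>
  Transported to the final time \<open>t\<close>, the measures become a family \<open>\<rho> b a\<close> with \<open>\<rho> c a\<close> the convolution of \<open>\<rho> c b\<close> and
  \<open>\<rho> b a\<close>. It is close to the point mass at 0 on short intervals on either side of a point; on the right-hand side this uses the
  uniform bound for the operators \<open>U t b\<close>, as \<open>b\<close> moves there. Compactness of \<open>[s, t]\<close>, in the form of Bolzano's
  bisection principle, cuts \<open>[s, t]\<close> into finitely many such intervals.
\<close>
lemma evolution_null_array:
  fixes U :: "real \<Rightarrow> real \<Rightarrow> ('a::{real_inner, polish_space} \<Rightarrow>\<^sub>L 'a)"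
    and \<mu> :: "real \<Rightarrow> real \<Rightarrow> 'a measure"
  assumes U: "evolution_family U"
    and bp: "\<And>t s. s \<le> t \<Longrightarrow> borel_prob (\<mu> t s)"
    and skew: "\<And>t r s. s \<le> r \<Longrightarrow> r \<le> t \<Longrightarrow>
           \<mu> t s = measure_conv (\<mu> t r) (distr (\<mu> r s) borel (blinfun_apply (U t r)))"
    and right: "\<And>s. weakly_converges (\<lambda>t. \<mu> t s) (return borel 0) (at_right s)"
    and left: "\<And>t. weakly_converges (\<lambda>s. \<mu> t s) (return borel 0) (at_left t)"
    and st: "s \<le> t" and F: "finite F"
  shows "null_array (\<mu> t s) F"
  unfolding null_array_def
proof (intro allI impI)
  fix \<delta> :: real assume \<delta>: "\<delta> > 0"
  define \<rho> where "\<rho> b a = distr (\<mu> b a) borel (blinfun_apply (U t b))" for b a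
  have Um: "blinfun_apply (U t b) \<in> measurable borel borel" for t b
    by (intro borel_measurable_continuous_onI continuous_intros)
  have \<rho>: "borel_prob (\<rho> b a)" if "a \<le> b" for a b
    unfolding \<rho>_def by (rule borel_prob_distr[OF bp[OF that] Um])
  have h\<rho>: "hchar (\<rho> b a) h = (\<integral>x. cis (U t b x \<bullet> h) \<partial>\<mu> b a)" if "a \<le> b" for a b h
    unfolding \<rho>_def by (rule hchar_distr) (use bp[OF that] Um in auto)
  have Utt: "U t t = id_blinfun" and Uc: "U t c o\<^sub>L U c b = U t b" if "b \<le> c" "c \<le> t" for b c t
    using U that by (auto simp: evolution_family_def)
  have mult: "hchar (\<rho> c a) h = hchar (\<rho> c b) h * hchar (\<rho> b a) h" if "a \<le> b" "b \<le> c" "c \<le> t" for a b c h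
  proof -
    have am: "(\<lambda>x. U t c x \<bullet> h) \<in> borel_measurable borel"
      by (intro borel_measurable_continuous_onI continuous_intros)
    have "hchar (\<rho> c a) h = (\<integral>x. cis (U t c x \<bullet> h) \<partial>measure_conv (\<mu> c b) (distr (\<mu> b a) borel (U c b)))"
      using skew[OF that(1,2)] h\<rho> that by simp
    also have "\<dots> = (\<integral>x. cis (U t c x \<bullet> h) \<partial>\<mu> c b) * (\<integral>y. cis (U t c y \<bullet> h) \<partial>distr (\<mu> b a) borel (U c b))"
      by (rule integral_cis_measure_conv[OF bp[OF that(2)] borel_prob_distr[OF bp[OF that(1)] Um] am])
         (simp add: blinfun.add_right inner_add_left)
    also have "(\<integral>y. cis (U t c y \<bullet> h) \<partial>distr (\<mu> b a) borel (U c b)) = (\<integral>y. cis (U t c (U c b y) \<bullet> h) \<partial>\<mu> b a)"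
    proof (rule integral_distr)
      show "blinfun_apply (U c b) \<in> measurable (\<mu> b a) borel"
        using Um bp[OF that(1)] by (simp cong: measurable_cong_sets)
      show "(\<lambda>y. cis (U t c y \<bullet> h)) \<in> borel_measurable borel"
        by (intro borel_measurable_continuous_onI continuous_intros)
    qed
    also have "\<dots> = hchar (\<rho> b a) h"
      using Uc[OF that(2,3)] h\<rho>[OF that(1)] by (metis (no_types, lifting) Bochner_Integration.integral_cong blinfun_apply_blinfun_compose)
    finally show ?thesis using h\<rho>[OF that(2)] by simp
  qed
  obtain B where B: "\<And>r. s \<le> r \<Longrightarrow> r \<le> t \<Longrightarrow> norm (U t r) \<le> B"
    using evolution_family_bounded[OF U] by metis
  have dev: "norm (hchar (\<rho> b a) h - 1) \<le> max 2 (norm (U t b) * norm h) * (\<integral>x. min 1 (norm x) \<partial>\<mu> b a)" if "a \<le> b" for a b h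
    unfolding h\<rho>[OF that] by (rule char_deviation_le[OF bp[OF that]]) simp
  \<comment> \<open>The measure of a degenerate interval is not assumed to be the point mass at 0. Convolution with it leaves
    \<open>\<rho> b a\<close> unchanged, and the characteristic function of \<open>\<rho> b a\<close> is nonzero for \<open>a\<close> close to \<open>b\<close>.\<close>
  have diag: "hchar (\<rho> b b) h = 1" if "b \<le> t" for b h
  proof -
    have "((\<lambda>a. max 2 (norm (U t b) * norm h) * (\<integral>x. min 1 (norm x) \<partial>\<mu> b a)) \<longlongrightarrow> max 2 (norm (U t b) * norm h) * 0) (at_left b)"
      by (intro tendsto_intros weakly_converges_point_mass_min_norm left)
    then have "\<forall>\<^sub>F a in at_left b. max 2 (norm (U t b) * norm h) * (\<integral>x. min 1 (norm x) \<partial>\<mu> b a) < 1"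
      by (rule order_tendstoD) simp
    moreover have "\<forall>\<^sub>F a in at_left b. a < b" by (simp add: eventually_at_filter)
    ultimately have "\<forall>\<^sub>F a in at_left b. a < b \<and> max 2 (norm (U t b) * norm h) * (\<integral>x. min 1 (norm x) \<partial>\<mu> b a) < 1"
      by eventually_elim simp
    then obtain a where a: "a < b" "max 2 (norm (U t b) * norm h) * (\<integral>x. min 1 (norm x) \<partial>\<mu> b a) < 1"
      using eventually_happens'[OF trivial_limit_at_left_real] by blast
    then have "norm (hchar (\<rho> b a) h - 1) < 1" using dev[of a b h] by simp
    then have "hchar (\<rho> b a) h \<noteq> 0" by auto
    then show ?thesis using mult[of a b b h] a that by simp
  qed
  define c where "c = 2 + (\<Sum>f\<in>F. \<bar>B\<bar> * norm f)"
  have c: "c > 0" unfolding c_def by (intro add_pos_nonneg sum_nonneg) auto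
  have cdev: "norm (hchar (\<rho> b a) f - 1) \<le> c * (\<integral>x. min 1 (norm x) \<partial>\<mu> b a)"
    if "a \<le> b" "s \<le> b" "b \<le> t" "f \<in> F" for a b f
  proof (rule order_trans[OF dev[OF that(1)] mult_right_mono])
    have "norm (U t b) * norm f \<le> \<bar>B\<bar> * norm f"
      using B[OF that(2,3)] by (intro mult_right_mono) auto
    also have "\<dots> \<le> (\<Sum>f\<in>F. \<bar>B\<bar> * norm f)"
      using F that(4) by (intro member_le_sum[of f F "\<lambda>f. \<bar>B\<bar> * norm f"]) auto
    finally show "max 2 (norm (U t b) * norm f) \<le> c"
      unfolding c_def using sum_nonneg[of F "\<lambda>f. \<bar>B\<bar> * norm f"] by simp
  qed (intro integral_nonneg_AE, simp)
  define factors where "factors b a ps \<longleftrightarrow> (\<forall>\<nu>\<in>set ps. borel_prob \<nu> \<and> (\<forall>f\<in>F. norm (hchar \<nu> f - 1) \<le> \<delta>)) \<and>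
       (\<forall>h. hchar (\<rho> b a) h = (\<Prod>\<nu>\<leftarrow>ps. hchar \<nu> h))" for a b ps
  define P where "P a b \<longleftrightarrow> (s \<le> a \<longrightarrow> a \<le> b \<longrightarrow> b \<le> t \<longrightarrow> (\<exists>ps. factors b a ps))" for a b
  from st have "P s t"
  proof (induction rule: Bolzano)
    case (trans a b c)
    show ?case unfolding P_def
    proof (intro impI)
      assume *: "s \<le> a" "a \<le> c" "c \<le> t"
      obtain ps where ps: "factors b a ps" using trans(1,3,4) * unfolding P_def by auto
      obtain qs where qs: "factors c b qs" using trans(2,3,4) * unfolding P_def by auto
      have "factors c a (qs @ ps)"
        using ps qs mult[OF trans(3,4) *(3)] unfolding factors_def by (simp add: ball_Un)
      then show "\<exists>ps. factors c a ps" ..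
    qed
  next
    case (local x)
    \<comment> \<open>An interval around \<open>x\<close> is split at \<open>x\<close>, since the hypotheses control only intervals that
      start or end at \<open>x\<close>.\<close>
    have "\<forall>\<^sub>F b in at_right x. (\<integral>y. min 1 (norm y) \<partial>\<mu> b x) < \<delta> / c"
      using weakly_converges_point_mass_min_norm[OF right[of x]] by (rule order_tendstoD) (use \<delta> c in simp)
    then obtain b0 where b0: "b0 > x" "\<And>b. x < b \<Longrightarrow> b < b0 \<Longrightarrow> (\<integral>y. min 1 (norm y) \<partial>\<mu> b x) < \<delta> / c"
      unfolding eventually_at_right_field by blast
    have "\<forall>\<^sub>F a in at_left x. (\<integral>y. min 1 (norm y) \<partial>\<mu> x a) < \<delta> / c"
      using weakly_converges_point_mass_min_norm[OF left[of x]] by (rule order_tendstoD) (use \<delta> c in simp)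
    then obtain a0 where a0: "a0 < x" "\<And>a. a0 < a \<Longrightarrow> a < x \<Longrightarrow> (\<integral>y. min 1 (norm y) \<partial>\<mu> x a) < \<delta> / c"
      unfolding eventually_at_left_field by blast
    have R: "norm (hchar (\<rho> b x) f - 1) \<le> \<delta>" if "x \<le> b" "b < b0" "b \<le> t" "f \<in> F" for b f
    proof (cases "b = x")
      case True then show ?thesis using diag that \<delta> by simp
    next
      case False
      then have "norm (hchar (\<rho> b x) f - 1) \<le> c * (\<integral>y. min 1 (norm y) \<partial>\<mu> b x)"
        using that local by (intro cdev) auto
      also have "\<dots> \<le> c * (\<delta> / c)" using b0(2)[of b] False that c by (intro mult_left_mono) auto
      finally show ?thesis using c by simp
    qed
    have L: "norm (hchar (\<rho> x a) f - 1) \<le> \<delta>" if "a \<le> x" "a0 < a" "f \<in> F" for a f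
    proof (cases "a = x")
      case True then show ?thesis using diag[of x] local \<delta> by simp
    next
      case False
      then have "norm (hchar (\<rho> x a) f - 1) \<le> c * (\<integral>y. min 1 (norm y) \<partial>\<mu> x a)"
        using that local by (intro cdev) auto
      also have "\<dots> \<le> c * (\<delta> / c)" using a0(2)[of a] False that c by (intro mult_left_mono) auto
      finally show ?thesis using c by simp
    qed
    show ?case
    proof (intro exI[of _ "min (b0 - x) (x - a0)"] conjI allI impI)
      show "0 < min (b0 - x) (x - a0)" using a0(1) b0(1) by simp
      fix a b assume ab: "a \<le> x \<and> x \<le> b \<and> b - a < min (b0 - x) (x - a0)"
      show "P a b" unfolding P_def
      proof (intro impI)
        assume "s \<le> a" "a \<le> b" "b \<le> t"
        have "hchar (\<rho> b a) h = hchar (\<rho> b x) h * hchar (\<rho> x a) h" for h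
          using ab \<open>b \<le> t\<close> by (intro mult) auto
        moreover have "borel_prob (\<rho> b x)" "borel_prob (\<rho> x a)" using ab by (auto intro!: \<rho>)
        ultimately have "factors b a [\<rho> b x, \<rho> x a]"
          using R[of b] L[of a] ab \<open>b \<le> t\<close> unfolding factors_def by simp
        then show "\<exists>ps. factors b a ps" ..
      qed
    qed
  qed
  then obtain ps where ps: "\<forall>\<nu>\<in>set ps. borel_prob \<nu> \<and> (\<forall>f\<in>F. norm (hchar \<nu> f - 1) \<le> \<delta>)"
    "\<And>h. hchar (\<rho> t s) h = (\<Prod>\<nu>\<leftarrow>ps. hchar \<nu> h)" using st unfolding P_def factors_def by auto
  have "hchar (\<rho> t s) = hchar (\<mu> t s)"
    using h\<rho>[OF st] Utt[of t t t] by (auto simp: hchar_def)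
  moreover have "(\<Prod>\<nu>\<leftarrow>ps. hchar \<nu> h) = (\<Prod>k<length ps. hchar (ps ! k) h)" for h
    by (simp add: prod.list_conv_set_nth atLeast0LessThan)
  ultimately have "(\<forall>k<length ps. borel_prob (ps ! k) \<and> (\<forall>f\<in>F. norm (hchar (ps ! k) f - 1) \<le> \<delta>)) \<and>
     (\<forall>h. hchar (\<mu> t s) h = (\<Prod>k<length ps. hchar (ps ! k) h))"
    using ps(1) ps(2) nth_mem by metis
  then show "\<exists>(N::nat) \<nu>. (\<forall>k<N. borel_prob (\<nu> k) \<and> (\<forall>f\<in>F. norm (hchar (\<nu> k) f - 1) \<le> \<delta>)) \<and>
     (\<forall>h. hchar (\<mu> t s) h = (\<Prod>k<N. hchar (\<nu> k) h))"
    by blast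
qed

theorem theorem3p21:
  fixes U :: "real \<Rightarrow> real \<Rightarrow> ('a::{real_inner, polish_space} \<Rightarrow>\<^sub>L 'a)"
    and \<mu> :: "real \<Rightarrow> real \<Rightarrow> 'a measure"
  assumes "evolution_family U"
    and "\<And>t s. s \<le> t \<Longrightarrow> prob_space (\<mu> t s)"
    and "\<And>t s. s \<le> t \<Longrightarrow> sets (\<mu> t s) = sets borel"
    and "\<And>t r s. s \<le> r \<Longrightarrow> r \<le> t \<Longrightarrow>
           \<mu> t s = measure_conv (\<mu> t r) (distr (\<mu> r s) borel (blinfun_apply (U t r)))"
    and "\<And>s. weakly_converges (\<lambda>t. \<mu> t s) (return borel 0) (at_right s)"
    and "\<And>t. weakly_converges (\<lambda>s. \<mu> t s) (return borel 0) (at_left t)"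
  shows "\<forall>t s. s \<le> t \<longrightarrow> infinitely_divisible (\<mu> t s)"
proof (intro allI impI)
  fix t s :: real assume st: "s \<le> t"
  have bp: "\<And>t s. s \<le> t \<Longrightarrow> borel_prob (\<mu> t s)" using assms(2,3) by blast
  show "infinitely_divisible (\<mu> t s)"
    by (rule infinitely_divisible_if_null_arrays[OF bp[OF st]])
       (rule evolution_null_array[OF assms(1) bp assms(4-6) st])
qed

end
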